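(* Let $\varphi:[0,1]\to[0,1]$ be an increasing bijection and $1\le r<\infty$ be such that $\|\cdot\|_{\Lambda_r(\varphi)}$ is equivalent to a norm. Let $\tilde\varphi(t)=1/\varphi(1/t)$, an increasing bijection of $[1,\infty)$ onto itself. Then $\Lambda_r(\varphi)$ is $D$-convex if and only if $t\mapsto(\tilde\varphi(t))^r$ is almost convex, and $\Lambda_r(\varphi)$ is $D^*$-convex if and only if $t\mapsto\tilde\varphi^{-1}(t^{1/r})$ is almost convex.
   Context: For measurable $x$ on $[0,1]$, $x^*$ is the decreasing rearrangement of $|x|$. $\Lambda_r(\varphi)$ is the space of functions on $[0,1]$ for which $\|x\|_{\Lambda_r(\varphi)}=\big(\int_0^1(x^*(t))^r\,d(\varphi(t))^r\big)^{1/r}$ is finite. For functions $x_1,\dots,x_n$ on $[0,1]$ let $C(x_1,\dots,x_n)(t)=|x_k(nt-k+1)|$ for $(k-1)/n<t<k/n$. A rearrangement invariant space $E$ on $[0,1]$ is $D$-convex if there is $c>0$ with $\|C(x_1,\dots,x_n)\|_E\le c\sup_k\|x_k\|_E$ for all $n$ and all $x_1,\dots,x_n$; it is $D^*$-convex if there is $c>0$ with $\|C(x_1,\dots,x_n)\|_E\ge c^{-1}\inf_k\|x_k\|_E$ for all $n$ and all $x_1,\dots,x_n$. An increasing bijection $M$ of $[1,\infty)$ onto itself is almost convex if there are numbers $a>1$, $b>1$ and a positive integer $N$ such that for all positive integers $m$, the cardinality of the set of integers $k$ for which the inequality $M(a^{k+m})\ge a^{m-N}M(a^k)$ fails is less than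 $b^m$; the inequality is regarded as true whenever it is undefined (i.e. when $a^k$ or $a^{k+m}$ lies outside the domain of $M$). *)

theory Defs
  imports "HOL-Analysis.Analysis"
begin

text \<open>
  A function on \<open>[0,1]\<close> is a total function of type \<open>real \<Rightarrow> real\<close>, of which only the values on
  \<open>{0..1}\<close> matter; measurability is Lebesgue measurability on \<open>{0..1}\<close>.
\<close>

definition increasing_bijection :: "real set \<Rightarrow> (real \<Rightarrow> real) \<Rightarrow> bool" where
  "increasing_bijection S f \<longleftrightarrow> strict_mono_on S f \<and> bij_betw f S S"

text \<open>Power with exponent \<open>p > 0\<close>, with \<open>\<infinity>\<close> to the power \<open>p\<close> equal to \<open>\<infinity>\<close>.\<close>

definition ennreal_powr :: "ennreal \<Rightarrow> real \<Rightarrow> ennreal" where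
  "ennreal_powr x p = (if x = \<infinity> then \<infinity> else ennreal (enn2real x powr p))"

text \<open>
  The decreasing rearrangement of \<open>\<bar>x\<bar>\<close> in its right-continuous version. Other versions differ
  from it at countably many points only, which are null for the atomless Stieltjes measures below.
\<close>

definition decr_rearrangement :: "(real \<Rightarrow> real) \<Rightarrow> real \<Rightarrow> ennreal" where
  "decr_rearrangement x t =
     Inf {s :: ennreal. emeasure (lebesgue_on {0..1}) {u \<in> {0..1}. s < ennreal \<bar>x u\<bar>} \<le> ennreal t}"

text \<open>
  The Lebesgue--Stieltjes measure of \<open>\<phi>\<^sup>r\<close> on \<open>[0,1]\<close>; \<open>\<phi>\<close> is extended to the real line by its
  values at the endpoints, so that no mass lies outside \<open>[0,1]\<close>.
\<close>

definition Lorentz_measure :: "(real \<Rightarrow> real) \<Rightarrow> real \<Rightarrow> real measure" where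
  "Lorentz_measure \<phi> r = interval_measure (\<lambda>t. \<phi> (max 0 (min 1 t)) powr r)"

definition Lorentz_norm :: "(real \<Rightarrow> real) \<Rightarrow> real \<Rightarrow> (real \<Rightarrow> real) \<Rightarrow> ennreal" where
  "Lorentz_norm \<phi> r x =
     ennreal_powr
       (\<integral>\<^sup>+ t\<in>{0..1}. ennreal_powr (decr_rearrangement x t) r \<partial>Lorentz_measure \<phi> r) (1 / r)"

definition Lorentz_space :: "(real \<Rightarrow> real) \<Rightarrow> real \<Rightarrow> (real \<Rightarrow> real) set" where
  "Lorentz_space \<phi> r = {x \<in> borel_measurable (lebesgue_on {0..1}). Lorentz_norm \<phi> r x < \<infinity>}"

text \<open>
  Norms on a space of functions in which functions that agree almost everywhere are identified.
  Invariance of \<open>P\<close> under this identification follows from the conditions below.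
\<close>

definition function_norm :: "(real \<Rightarrow> real) set \<Rightarrow> ((real \<Rightarrow> real) \<Rightarrow> real) \<Rightarrow> bool" where
  "function_norm E P \<longleftrightarrow>
     (\<lambda>t. 0) \<in> E \<and>
     (\<forall>x\<in>E. \<forall>y\<in>E. (\<lambda>t. x t + y t) \<in> E) \<and>
     (\<forall>a. \<forall>x\<in>E. (\<lambda>t. a * x t) \<in> E) \<and>
     (\<forall>x\<in>E. P x \<ge> 0 \<and> (P x = 0 \<longleftrightarrow> (AE t in lebesgue_on {0..1}. x t = 0))) \<and>
     (\<forall>x\<in>E. \<forall>y\<in>E. P (\<lambda>t. x t + y t) \<le> P x + P y) \<and>
     (\<forall>a. \<forall>x\<in>E. P (\<lambda>t. a * x t) = \<bar>a\<bar> * P x)"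

definition equivalent_to_norm :: "(real \<Rightarrow> real) set \<Rightarrow> ((real \<Rightarrow> real) \<Rightarrow> ennreal) \<Rightarrow> bool" where
  "equivalent_to_norm E N \<longleftrightarrow>
     (\<exists>P. function_norm E P \<and>
       (\<exists>c>0. \<exists>C>0. \<forall>x\<in>E. ennreal c * N x \<le> ennreal (P x) \<and> ennreal (P x) \<le> ennreal C * N x))"

text \<open>
  The function \<open>C(x\<^sub>1, \<dots>, x\<^sub>n)\<close>. At most one summand is nonzero at each point; at the
  points \<open>k/n\<close>, where the function need not be defined, this version is \<open>0\<close>.
\<close>

definition concat_functions :: "nat \<Rightarrow> (nat \<Rightarrow> real \<Rightarrow> real) \<Rightarrow> real \<Rightarrow> real" where
  "concat_functions n x t =
     (\<Sum>k=1..n. indicator {(real k - 1) / real n<..<real k / real n} t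
                * \<bar>x k (real n * t - real k + 1)\<bar>)"

definition D_convex :: "(real \<Rightarrow> real) set \<Rightarrow> ((real \<Rightarrow> real) \<Rightarrow> ennreal) \<Rightarrow> bool" where
  "D_convex E N \<longleftrightarrow>
     (\<exists>c>0. \<forall>n\<ge>1. \<forall>x. (\<forall>k\<in>{1..n}. x k \<in> E) \<longrightarrow>
        N (concat_functions n x) \<le> ennreal c * (SUP k\<in>{1..n}. N (x k)))"

definition D_star_convex :: "(real \<Rightarrow> real) set \<Rightarrow> ((real \<Rightarrow> real) \<Rightarrow> ennreal) \<Rightarrow> bool" where
  "D_star_convex E N \<longleftrightarrow>
     (\<exists>c>0. \<forall>n\<ge>1. \<forall>x. (\<forall>k\<in>{1..n}. x k \<in> E) \<longrightarrow>
        N (concat_functions n x) \<ge> ennreal (inverse c) * (INF k\<in>{1..n}. N (x k)))"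

text \<open>
  The integers \<open>k\<close> for which the inequality is defined and fails; for increasing bijections \<open>M\<close> of
  \<open>{1..}\<close> onto itself. Since \<open>card\<close> of an infinite set is \<open>0\<close>, finiteness is required separately.
\<close>

definition almost_convex :: "(real \<Rightarrow> real) \<Rightarrow> bool" where
  "almost_convex M \<longleftrightarrow>
     (\<exists>a>1. \<exists>b>1. \<exists>N::nat. N \<ge> 1 \<and>
       (\<forall>m::nat. m \<ge> 1 \<longrightarrow>
         (let S = {k::int. a powi k \<in> {1..} \<and> a powi (k + int m) \<in> {1..} \<and>
                     \<not> (M (a powi (k + int m)) \<ge> a powi (int m - int N) * M (a powi k))}
          in finite S \<and> real (card S) < b ^ m)))"

definition phi_tilde :: "(real \<Rightarrow> real) \<Rightarrow> real \<Rightarrow> real" where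
  "phi_tilde \<phi> t = 1 / \<phi> (1 / t)"

lemma increasing_bijection_phi_tilde:
  assumes "increasing_bijection {0..1} \<phi>"
  shows "increasing_bijection {1..} (phi_tilde \<phi>)"
proof -
  have sm: "strict_mono_on {0..1} \<phi>" and bij: "bij_betw \<phi> {0..1} {0..1}"
    using assms by (auto simp: increasing_bijection_def)
  have img: "\<phi> ` {0..1} = {0..1}"
    using bij by (simp add: bij_betw_def)
  have nn: "\<phi> s \<ge> 0" and le1: "\<phi> s \<le> 1" if "s \<in> {0..1}" for s
    using img that by auto
  obtain z where z: "z \<in> {0..1}" "\<phi> z = 0"
    using img by (metis atLeastAtMost_iff imageE order_refl zero_le_one)
  have z0: "z = 0"
    using strict_mono_onD[OF sm, of 0 z] z nn[of 0] by fastforce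
  have pos: "\<phi> s > 0" if "0 < s" "s \<le> 1" for s
    using strict_mono_onD[OF sm, of 0 s] that z z0 by auto
  have sm': "strict_mono_on {1..} (phi_tilde \<phi>)"
  proof (rule strict_mono_onI)
    fix s t :: real assume "s \<in> {1..}" "t \<in> {1..}" "s < t"
    then have "\<phi> (1 / t) < \<phi> (1 / s)" "\<phi> (1 / t) > 0"
      using pos by (auto intro!: strict_mono_onD[OF sm] simp: field_simps)
    then show "phi_tilde \<phi> s < phi_tilde \<phi> t"
      by (simp add: phi_tilde_def frac_less2)
  qed
  have "phi_tilde \<phi> ` {1..} = {1..}"
  proof (intro set_eqI iffI)
    fix y assume "y \<in> phi_tilde \<phi> ` {1..}"
    then obtain t where "t \<ge> 1" "y = 1 / \<phi> (1 / t)"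
      by (auto simp: phi_tilde_def)
    with pos[of "1 / t"] le1[of "1 / t"] show "y \<in> {1..}"
      by auto
  next
    fix y :: real assume y: "y \<in> {1..}"
    then have "1 / y \<in> \<phi> ` {0..1}"
      using img by auto
    then obtain s where s: "s \<in> {0..1}" "1 / y = \<phi> s"
      by auto
    have "s \<noteq> 0" using s y z z0 by auto
    then have "1 / s \<in> {1..}" "phi_tilde \<phi> (1 / s) = y"
      using s y by (auto simp: phi_tilde_def simp flip: s(2))
    then show "y \<in> phi_tilde \<phi> ` {1..}"
      by force
  qed
  with sm' show ?thesis
    by (simp add: increasing_bijection_def bij_betw_def strict_mono_on_imp_inj_on)
qed

end

theory Submission
  imports Defs
begin

text \<open>
  Put \<open>\<Phi> = \<phi>\<^sup>r\<close> and \<open>d(s) = \<lambda>(\<bar>x\<bar>\<^sup>r > s)\<close>. By the layer cake formula the \<open>r\<close>-th power of the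
  Lorentz norm of \<open>x\<close> is \<open>\<integral>\<^sub>0\<^sup>\<infinity> \<Phi>(d(s)) ds\<close>, and \<open>C(x\<^sub>1, \<dots>, x\<^sub>n)\<close> has the mean of the functions \<open>d\<^sub>j\<close> as its
  level function. So \<open>D\<close>-convexity says that this integral of a mean is bounded by the largest of
  the single integrals, and \<open>D\<^sup>*\<close>-convexity is the reverse statement with the smallest one. Almost
  convexity of the two functions in the theorem is a condition on \<open>p\<^sub>k = \<Phi>(a\<^sup>-\<^sup>k)\<close> and the same
  condition on \<open>q\<^sub>k = \<Phi>\<^sup>-\<^sup>1(a\<^sup>-\<^sup>k)\<close>.

  Almost convexity implies the inequalities: Chopping \<open>m\<close> into \<open>L\<close> pieces makes the number of
  exceptional \<open>k\<close> small against \<open>a\<^sup>m\<close>. Hence the inequality \<open>a\<^sup>i p\<^sub>k \<le> A p\<^sub>k\<^sub>-\<^sub>i\<close> holds for all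
  \<open>i \<le> \<tau>(k)\<close>, where \<open>\<Sum>\<^sub>k (1/a)^\<tau>(k)\<close> converges. At the points \<open>s\<close> where the mean \<open>d(s)\<close> is of
  the order \<open>a\<^sup>-\<^sup>k\<close>, either \<open>\<Phi>(d(s))\<close> is bounded by the mean of the \<open>\<Phi>(d\<^sub>j(s))\<close>, or \<open>s\<close> is so small
  that these points contribute at most a multiple of \<open>(1/a)^\<tau>(k)\<close> to the integral; the weak type
  bound \<open>s \<Phi>(d\<^sub>j(s)) \<le> \<integral> \<Phi>(d\<^sub>j)\<close> separates the two cases. The reverse inequality is similar, with
  the exceptional points indexed by the order of \<open>\<Phi>(d\<^sub>j(s))\<close> instead.

  Conversely, take \<open>a = 2\<close>. From \<open>2\<^sup>m\<close> exceptional \<open>k\<close> along which \<open>p\<^sub>k\<close> decreases geometrically one gets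
  normalized indicator functions that violate the inequality, and if there are no such chains,
  then the exceptional sets have at most exponential size.
\<close>

section \<open>Sequences with few exceptional indices\<close>

text \<open>If \<open>M (a ^ k) = 1 / p k\<close>, these are the indices at which the inequality
  between \<open>M (a ^ (k + m))\<close> and \<open>M (a ^ k)\<close> in the notion of almost
  convexity fails, multiplied out so that only natural exponents occur.\<close>

definition bad :: "(nat \<Rightarrow> real) \<Rightarrow> real \<Rightarrow> nat \<Rightarrow> nat \<Rightarrow> nat set" where
  "bad p a N m = {k. a ^ N * p k < a ^ m * p (k + m)}"

definition almost_convex_seq :: "real \<Rightarrow> (nat \<Rightarrow> real) \<Rightarrow> bool" where
  "almost_convex_seq a p \<longleftrightarrow>
     (\<exists>b>1. \<exists>N\<ge>1. \<forall>m\<ge>1. finite (bad p a N m) \<and> real (card (bad p a N m)) < b ^ m)"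

text \<open>Cut the way from \<open>k\<close> to \<open>k + m\<close> into \<open>L\<close> chunks
  of length \<open>m div L\<close>. If no chunk starts at an exceptional index, the \<open>L\<close>
  inequalities multiply to a loss of \<open>a ^ (L * N)\<close>. The fewer than \<open>L\<close>
  steps that remain lose at most \<open>a ^ L\<close>, as \<open>p\<close> is antitone.\<close>

lemma bad_imp_bad_chunk:
  assumes a: "a > 1" and p: "antimono p" "\<And>k. p k > 0" and L: "L > 0"
    and k: "k \<in> bad p a (L * (N + 1)) m"
  shows "\<exists>i<L. k + i * (m div L) \<in> bad p a N (m div L)"
proof (rule ccontr)
  define c where "c = m div L"
  assume "\<not> ?thesis"
  then have step: "a ^ c * p (k + i * c + c) \<le> a ^ N * p (k + i * c)" if "i < L" for i
    using that by (fastforce simp: bad_def c_def not_less add.assoc)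
  have "i \<le> L \<Longrightarrow> a ^ (i * c) * p (k + i * c) \<le> a ^ (i * N) * p k" for i
  proof (induction i)
    case (Suc i)
    have "a ^ (Suc i * c) * p (k + Suc i * c) = a ^ (i * c) * (a ^ c * p (k + i * c + c))"
      by (simp add: power_add algebra_simps)
    also have "\<dots> \<le> a ^ (i * c) * (a ^ N * p (k + i * c))"
      using step[of i] Suc.prems a by (intro mult_left_mono) auto
    also have "\<dots> = a ^ N * (a ^ (i * c) * p (k + i * c))" by simp
    also have "\<dots> \<le> a ^ N * (a ^ (i * N) * p k)"
      using Suc a by (intro mult_left_mono) auto
    finally show ?case by (simp add: power_add algebra_simps)
  qed simp
  from this[of L] have 1: "a ^ (L * c) * p (k + L * c) \<le> a ^ (L * N) * p k" by simp
  have m: "m = L * c + m mod L" "m mod L < L" using L by (auto simp: c_def)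
  have "a ^ (L * (N + 1)) * p k < a ^ m * p (k + m)"
    using k by (simp add: bad_def)
  also have "\<dots> \<le> a ^ (L * c + L) * p (k + L * c)"
    using m a p(2)[of "k + m"] antimonoD[OF p(1), of "k + L * c" "k + m"]
    by (intro mult_mono power_increasing) auto
  also have "\<dots> = a ^ L * (a ^ (L * c) * p (k + L * c))"
    by (simp add: power_add)
  also have "\<dots> \<le> a ^ L * (a ^ (L * N) * p k)"
    using 1 a by (intro mult_left_mono) auto
  also have "\<dots> = a ^ (L * (N + 1)) * p k"
    by (simp add: power_add algebra_simps)
  finally show False by simp
qed

lemma bad_0: "a > 1 \<Longrightarrow> (\<And>k. p k > 0) \<Longrightarrow> bad p a N 0 = {}"
  by (simp add: bad_def not_less)

text \<open>Weakening \<open>N\<close> to \<open>L (N + 1)\<close> replaces the growth rate \<open>b\<close> by its \<open>L\<close>-th root.\<close>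

lemma card_bad_le_sqrt:
  assumes a: "a > 1" and p: "antimono p" "\<And>k. p k > 0" and ac: "almost_convex_seq a p"
  obtains L N :: nat where
    "\<And>m. finite (bad p a N m)" "\<And>m. real (card (bad p a N m)) \<le> real L * sqrt a ^ m"
proof -
  obtain b N where b: "b > 1"
    and fin: "\<And>m. m \<ge> 1 \<Longrightarrow> finite (bad p a N m)"
    and card: "\<And>m. m \<ge> 1 \<Longrightarrow> real (card (bad p a N m)) < b ^ m"
    using ac by (auto simp: almost_convex_seq_def)
  have e0: "bad p a N 0 = {}" using bad_0[OF a p(2)] .
  have fin': "finite (bad p a N m)" for m using fin[of m] e0 by (cases m) auto
  have card': "real (card (bad p a N m)) \<le> b ^ m" for m
    using card[of m] e0 by (cases m) auto
  \<comment> \<open>The growth over one chunk, \<open>b ^ (m div L)\<close>, is at most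
    \<open>sqrt a ^ m\<close> once \<open>b \<le> sqrt a ^ L\<close>. A rate below \<open>a\<close>
    makes the series in \<open>summable_first_hit\<close> converge.\<close>
  have "sqrt a > 1" using a by simp
  then obtain L0 where L0: "b < sqrt a ^ L0" using real_arch_pow by blast
  define L where "L = Suc L0"
  have L: "L > 0" "b \<le> sqrt a ^ L"
    using L0 power_increasing[of L0 L "sqrt a"] a by (auto simp: L_def intro: order.trans[OF less_imp_le])
  show thesis
  proof
    fix m
    define c where "c = m div L"
    have sub: "bad p a (L * (N + 1)) m \<subseteq> (\<Union>i<L. (\<lambda>k. k - i * c) ` bad p a N c)"
    proof
      fix k assume "k \<in> bad p a (L * (N + 1)) m"
      from bad_imp_bad_chunk[OF a p L(1) this] obtain i where
        "i < L" "k + i * c \<in> bad p a N c" by (auto simp: c_def)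
      then show "k \<in> (\<Union>i<L. (\<lambda>k. k - i * c) ` bad p a N c)"
        by (auto intro!: bexI[of _ i] image_eqI[of _ _ "k + i * c"])
    qed
    show "finite (bad p a (L * (N + 1)) m)"
      by (rule finite_subset[OF sub]) (use fin' in auto)
    have "card (bad p a (L * (N + 1)) m) \<le> (\<Sum>i<L. card ((\<lambda>k. k - i * c) ` bad p a N c))"
      using card_mono[OF _ sub] card_UN_le[of "{..<L}" "\<lambda>i. (\<lambda>k. k - i * c) ` bad p a N c"] fin'
      by (meson finite_UN_I finite_imageI finite_lessThan le_trans)
    also have "\<dots> \<le> (\<Sum>i<L. card (bad p a N c))"
      by (intro sum_mono card_image_le fin')
    finally have "card (bad p a (L * (N + 1)) m) \<le> L * card (bad p a N c)" by simp
    then have "real (card (bad p a (L * (N + 1)) m)) \<le> real L * real (card (bad p a N c))"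
      by (metis of_nat_le_iff of_nat_mult)
    also have "\<dots> \<le> real L * (sqrt a ^ L) ^ c"
      using card'[of c] power_mono[OF L(2), of c] b by (intro mult_left_mono) auto
    also have "\<dots> \<le> real L * sqrt a ^ m"
      using a by (intro mult_left_mono) (auto simp: c_def simp flip: power_mult intro!: power_increasing)
    finally show "real (card (bad p a (L * (N + 1)) m)) \<le> real L * sqrt a ^ m" .
  qed
qed

text \<open>Let \<open>\<tau> k\<close> be the number of steps before \<open>k\<close> first enters
  some \<open>B m\<close>. The \<open>k\<close> with value \<open>t\<close> that do enter lie in
  \<open>B (Suc t)\<close>, so together they contribute at most
  \<open>L * sqrt a ^ Suc t * (1 / a) ^ t\<close>, the terms of a geometric series with ratio
  \<open>1 / sqrt a\<close>.\<close>

lemma summable_first_hit: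
  fixes B :: "nat \<Rightarrow> nat set" and a :: real
  assumes a: "a > 1" and B0: "B 0 = {}" and fin: "\<And>m. finite (B m)"
    and card: "\<And>m. real (card (B m)) \<le> L * sqrt a ^ m"
  obtains \<tau> where "\<And>k i. i \<le> \<tau> k \<Longrightarrow> k \<notin> B i" "summable (\<lambda>k. (1 / a) ^ \<tau> k)"
proof -
  \<comment> \<open>The alternative \<open>t = k\<close> gives a finite value to indices that are
    never hit; these add at most the geometric series with ratio \<open>1 / a\<close>.\<close>
  define \<tau> where "\<tau> k = (LEAST t. k \<in> B (Suc t) \<or> t = k)" for k
  have ex: "k \<in> B (Suc (\<tau> k)) \<or> \<tau> k = k" for k
    unfolding \<tau>_def by (rule LeastI[of _ k]) auto
  have le: "\<tau> k \<le> k" for k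
    unfolding \<tau>_def by (rule Least_le) auto
  have notin: "k \<notin> B i" if "i \<le> \<tau> k" for k i
  proof (cases i)
    case (Suc t)
    then have "t < \<tau> k" using that by simp
    then show ?thesis unfolding \<tau>_def using Suc not_less_Least by blast
  qed (use B0 in auto)
  define x where "x = 1 / sqrt a"
  have x: "0 < x" "x < 1" using a by (auto simp: x_def)
  have x2: "x * x = 1 / a" using a by (simp add: x_def)
  have L0: "L \<ge> 0" using card[of 0] B0 by simp
  have one: "sqrt a * x = 1" using a by (simp add: x_def)
  have geo: "(\<Sum>k<n. y ^ k) \<le> 1 / (1 - y)" if "0 < y" "y < 1" for y :: real and n
    using sum_le_suminf[of "\<lambda>k. y ^ k" "{..<n}"] that by (simp add: suminf_geometric summable_geometric)
  have "summable (\<lambda>k. (1 / a) ^ \<tau> k)"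
  proof (rule summableI_nonneg_bounded)
    show "0 \<le> (1 / a) ^ \<tau> k" for k using a by simp
    fix n
    have "(\<Sum>k<n. (1 / a) ^ \<tau> k)
        \<le> (\<Sum>k<n. (1 / a) ^ k + (\<Sum>t<n. (1 / a) ^ t * indicator (B (Suc t)) k))"
    proof (intro sum_mono)
      fix k assume k: "k \<in> {..<n}"
      have nn: "0 \<le> (\<Sum>t<n. (1 / a) ^ t * indicator (B (Suc t)) k)"
        using a by (intro sum_nonneg) auto
      show "(1 / a) ^ \<tau> k \<le> (1 / a) ^ k + (\<Sum>t<n. (1 / a) ^ t * indicator (B (Suc t)) k)"
        using ex[of k]
      proof
        assume "k \<in> B (Suc (\<tau> k))"
        then have "(1 / a) ^ \<tau> k = (1 / a) ^ \<tau> k * indicator (B (Suc (\<tau> k))) k" by simp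
        also have "\<dots> \<le> (\<Sum>t<n. (1 / a) ^ t * indicator (B (Suc t)) k)"
          using k le[of k] a by (intro member_le_sum) auto
        finally show ?thesis using a by (simp add: add_increasing)
      qed (use nn in auto)
    qed
    also have "\<dots> = (\<Sum>k<n. (1 / a) ^ k) + (\<Sum>t<n. (1 / a) ^ t * (\<Sum>k<n. indicator (B (Suc t)) k))"
      unfolding sum.distrib sum_distrib_left by (subst sum.swap) rule
    also have "\<dots> \<le> 1 / (1 - 1 / a) + (\<Sum>t<n. L * sqrt a * x ^ t)"
    proof (intro add_mono geo sum_mono)
      fix t
      have "(\<Sum>k<n. indicator (B (Suc t)) k) = real (card ({..<n} \<inter> B (Suc t)))"
        by (simp add: indicator_def sum.If_cases Int_def)
      also have "\<dots> \<le> real (card (B (Suc t)))"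
        by (simp add: card_mono fin)
      finally have "(1 / a) ^ t * (\<Sum>k<n. indicator (B (Suc t)) k) \<le> (1 / a) ^ t * (L * sqrt a ^ Suc t)"
        using card[of "Suc t"] a by (intro mult_left_mono) auto
      also have "\<dots> = L * sqrt a * x ^ t * (sqrt a * x) ^ t"
        unfolding x2[symmetric] by (simp add: power_mult_distrib)
      finally show "(1 / a) ^ t * (\<Sum>k<n. indicator (B (Suc t)) k) \<le> L * sqrt a * x ^ t"
        by (simp add: one)
    qed (use a in auto)
    also have "\<dots> \<le> 1 / (1 - 1 / a) + L * sqrt a * (1 / (1 - x))"
      unfolding sum_distrib_left[symmetric] using L0 a x
      by (intro add_mono mult_left_mono geo) auto
    finally show "(\<Sum>k<n. (1 / a) ^ \<tau> k) \<le> 1 / (1 - 1 / a) + L * sqrt a * (1 / (1 - x))" .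
  qed
  with notin that show thesis by blast
qed

text \<open>The inequality is wanted for a fixed upper index \<open>k\<close>. So the exceptional
  sets are translated by \<open>m\<close>, which indexes them by their upper ends and keeps their
  cardinalities.\<close>

lemma almost_convex_seq_backward:
  assumes a: "a > 1" and p: "antimono p" "\<And>k. p k > 0" and ac: "almost_convex_seq a p"
  obtains A \<tau> where "A \<ge> 1" "summable (\<lambda>k. (1 / a) ^ \<tau> k)"
    "\<And>k i. i \<le> \<tau> k \<Longrightarrow> i \<le> k \<Longrightarrow> a ^ i * p k \<le> A * p (k - i)"
proof -
  obtain L N :: nat where fin: "\<And>m. finite (bad p a N m)"
    and card: "\<And>m. real (card (bad p a N m)) \<le> real L * sqrt a ^ m"
    by (rule card_bad_le_sqrt[OF a p ac]) (rule that; assumption)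
  define B where "B m = (\<lambda>k. k + m) ` bad p a N m" for m
  have B0: "B 0 = {}" using bad_0[OF a p(2)] by (auto simp: B_def)
  have finB: "finite (B m)" and cardB: "real (card (B m)) \<le> real L * sqrt a ^ m" for m
    using fin card by (auto simp: B_def card_image)
  obtain \<tau> where \<tau>: "\<And>k i. i \<le> \<tau> k \<Longrightarrow> k \<notin> B i" "summable (\<lambda>k. (1 / a) ^ \<tau> k)"
    by (rule summable_first_hit[where B = B, OF a B0 finB cardB]) (rule that; assumption)
  show thesis
  proof (rule that[of "a ^ N" \<tau>])
    fix k i assume "i \<le> \<tau> k" and i: "i \<le> k"
    then have "k \<notin> B i" using \<tau> by blast
    with i have "k - i \<notin> bad p a N i" by (force simp: B_def)
    with i show "a ^ i * p k \<le> a ^ N * p (k - i)" by (simp add: bad_def)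
  qed (use \<tau> a in auto)
qed

text \<open>Here the lower index is fixed. At the end of the good range the quotient is at most
  \<open>a ^ N * (1 / a) ^ \<tau>\<^sub>0 k\<close>, so the series converges. To push its sum below
  \<delta>, \<open>\<tau>\<^sub>0\<close> is kept on a tail with small sum and replaced on the
  finitely many other indices by one large \<open>T\<close>, which exists because \<open>p\<close>
  tends to 0. The price is a larger \<open>A\<close>.\<close>

lemma almost_convex_seq_forward:
  assumes a: "a > 1" and p: "antimono p" "\<And>k. p k > 0" "p \<longlonglongrightarrow> 0"
    and ac: "almost_convex_seq a p" and \<delta>: "\<delta> > 0"
  obtains A \<tau> where "A \<ge> 1" "summable (\<lambda>k. p (k + \<tau> k) / p k)" "(\<Sum>k. p (k + \<tau> k) / p k) \<le> \<delta>"
    "\<And>k i. i \<le> \<tau> k \<Longrightarrow> a ^ i * p (k + i) \<le> A * p k"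
proof -
  obtain L N :: nat where fin: "\<And>m. finite (bad p a N m)"
    and card: "\<And>m. real (card (bad p a N m)) \<le> real L * sqrt a ^ m"
    by (rule card_bad_le_sqrt[OF a p(1,2) ac]) (rule that; assumption)
  have B0: "bad p a N 0 = {}" using bad_0[OF a p(2)] .
  obtain \<tau>\<^sub>0 where \<tau>\<^sub>0: "\<And>k i. i \<le> \<tau>\<^sub>0 k \<Longrightarrow> k \<notin> bad p a N i" "summable (\<lambda>k. (1 / a) ^ \<tau>\<^sub>0 k)"
    by (rule summable_first_hit[where B = "bad p a N", OF a B0 fin card]) (rule that; assumption)
  have A0: "a ^ i * p (k + i) \<le> a ^ N * p k" if "i \<le> \<tau>\<^sub>0 k" for k i
    using \<tau>\<^sub>0(1)[OF that] unfolding bad_def by simp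
  define \<delta>\<^sub>0 where "\<delta>\<^sub>0 k = p (k + \<tau>\<^sub>0 k) / p k" for k
  have \<delta>\<^sub>0: "0 \<le> \<delta>\<^sub>0 k" "\<delta>\<^sub>0 k \<le> a ^ N * (1 / a) ^ \<tau>\<^sub>0 k" for k
    using A0[of "\<tau>\<^sub>0 k" k] p(2) a by (auto simp: \<delta>\<^sub>0_def field_simps less_imp_le)
  have sum0: "summable \<delta>\<^sub>0"
    by (rule summable_comparison_test'[OF summable_mult[OF \<tau>\<^sub>0(2), of "a ^ N"], of 0]) (use \<delta>\<^sub>0 in auto)
  obtain l where l: "norm (\<Sum>k. \<delta>\<^sub>0 (k + l)) < \<delta> / 2"
    using suminf_exist_split[OF _ sum0, of "\<delta> / 2"] \<delta> by auto
  \<comment> \<open>The \<open>l\<close> initial terms then add up to at most \<delta>/2;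
    \<open>Suc l\<close> in place of \<open>l\<close> keeps the denominator positive when there are
    no such terms.\<close>
  have "\<exists>T. \<forall>k<l. p (k + T) / p k \<le> \<delta> / (2 * Suc l)"
  proof -
    have "(\<lambda>T. p (k + T) / p k) \<longlonglongrightarrow> 0" for k
      using tendsto_divide[OF LIMSEQ_ignore_initial_segment[OF p(3), of k] tendsto_const[of "p k"]] p(2)[of k]
      by (simp add: add.commute)
    moreover have "0 < \<delta> / (2 * Suc l)" using \<delta> by simp
    ultimately have "\<forall>k\<in>{..<l}. eventually (\<lambda>T. p (k + T) / p k < \<delta> / (2 * Suc l)) sequentially"
      using order_tendstoD(2) by blast
    then have "eventually (\<lambda>T. \<forall>k\<in>{..<l}. p (k + T) / p k < \<delta> / (2 * Suc l)) sequentially"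
      by (intro eventually_ball_finite) auto
    then show ?thesis
      unfolding eventually_sequentially by (meson lessThan_iff less_imp_le order_refl)
  qed
  then obtain T where T: "\<And>k. k < l \<Longrightarrow> p (k + T) / p k \<le> \<delta> / (2 * Suc l)" by blast
  define \<tau> where "\<tau> k = (if k < l then T else \<tau>\<^sub>0 k)" for k
  have tail: "(\<lambda>k. p (k + l + \<tau> (k + l)) / p (k + l)) = (\<lambda>k. \<delta>\<^sub>0 (k + l))"
    by (auto simp: \<tau>_def \<delta>\<^sub>0_def)
  have sm: "summable (\<lambda>k. p (k + \<tau> k) / p k)"
    using summable_iff_shift[of "\<lambda>k. p (k + \<tau> k) / p k" l] summable_iff_shift[of \<delta>\<^sub>0 l] sum0 tail
    by metis
  have "(\<Sum>k<l. p (k + \<tau> k) / p k) \<le> (\<Sum>k<l. \<delta> / (2 * Suc l))"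
    by (intro sum_mono) (use T in \<open>auto simp: \<tau>_def\<close>)
  also have "\<dots> \<le> \<delta> / 2"
    using \<delta> by (simp add: field_simps)
  finally have "(\<Sum>k<l. p (k + \<tau> k) / p k) \<le> \<delta> / 2" .
  then have "(\<Sum>k. p (k + \<tau> k) / p k) \<le> \<delta>"
    unfolding suminf_split_initial_segment[OF sm, of l] tail using l by simp
  moreover have "a ^ i * p (k + i) \<le> max (a ^ N) (a ^ T) * p k" if "i \<le> \<tau> k" for k i
  proof (cases "k < l")
    case True
    then have "a ^ i * p (k + i) \<le> a ^ T * p k"
      using that a p(2)[of "k + i"] antimonoD[OF p(1), of k "k + i"]
      by (intro mult_mono power_increasing) (auto simp: \<tau>_def)
    also have "\<dots> \<le> max (a ^ N) (a ^ T) * p k"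
      using p(2)[of k] by (intro mult_right_mono) auto
    finally show ?thesis .
  next
    case False
    then have "a ^ i * p (k + i) \<le> a ^ N * p k"
      using that A0 by (auto simp: \<tau>_def)
    also have "\<dots> \<le> max (a ^ N) (a ^ T) * p k"
      using p(2)[of k] by (intro mult_right_mono) auto
    finally show ?thesis .
  qed
  moreover have "max (a ^ N) (a ^ T) \<ge> 1" using a by (simp add: le_max_iff_disj)
  ultimately show thesis using that sm by blast
qed

text \<open>An infinite exceptional set contains an infinite chain, because \<open>p\<close> tends
  to 0. Finiteness for the single value \<open>Suc N\<close> of \<open>m\<close> makes
  \<open>p\<close> drop by half over some fixed number \<open>L\<close> of indices. Hence every
  \<open>L\<close>-th exceptional index gives a chain again, and there are fewer than
  \<open>L * 2 ^ m\<close> exceptional indices.\<close>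

lemma almost_convex_seqI:
  fixes p :: "nat \<Rightarrow> real"
  assumes p: "antimono p" "\<And>k. p k > 0" "p \<longlonglongrightarrow> 0" and N: "N \<ge> 1"
    and no_chain: "\<And>m \<kappa>. m \<ge> 1 \<Longrightarrow> (\<And>i. i < 2 ^ m \<Longrightarrow> \<kappa> i \<in> bad p 2 N m) \<Longrightarrow>
       (\<And>i. Suc i < 2 ^ m \<Longrightarrow> p (\<kappa> (Suc i)) \<le> p (\<kappa> i) / 2) \<Longrightarrow> False"
  shows "almost_convex_seq 2 p"
proof -
  have fin: "finite (bad p 2 N m)" if m: "m \<ge> 1" for m
  proof (rule ccontr)
    assume inf: "infinite (bad p 2 N m)"
    have "\<exists>\<kappa>. \<forall>i. \<kappa> i \<in> bad p 2 N m \<and> p (\<kappa> (Suc i)) \<le> p (\<kappa> i) / 2"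
    proof (rule dependent_nat_choice)
      show "\<exists>x. x \<in> bad p 2 N m" using inf by (metis finite.emptyI ex_in_conv)
    next
      fix x i
      have "eventually (\<lambda>k. p k < p x / 2) sequentially"
        using p by (intro order_tendstoD) auto
      then obtain K where K: "\<And>k. k \<ge> K \<Longrightarrow> p k < p x / 2"
        by (auto simp: eventually_sequentially)
      from inf obtain y where "y \<in> bad p 2 N m" "y \<ge> K"
        unfolding infinite_nat_iff_unbounded_le by blast
      then show "\<exists>y. y \<in> bad p 2 N m \<and> p y \<le> p x / 2" using K[of y] by auto
    qed
    then show False using no_chain[OF m] by blast
  qed
  \<comment> \<open>Outside \<open>bad p 2 N (Suc N)\<close> the inequality reads
    \<open>2 * p (k + Suc N) \<le> p k\<close>. The finitely many indices below \<open>K\<close> are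
    handled by the convergence of \<open>p\<close> to 0.\<close>
  obtain K where K: "\<And>k. k \<in> bad p 2 N (Suc N) \<Longrightarrow> k < K"
    using fin[of "Suc N"] by (auto simp: finite_nat_set_iff_bounded)
  have "eventually (\<lambda>k. p k < p K / 2) sequentially"
    using p by (intro order_tendstoD) auto
  then obtain L\<^sub>0 where L0: "p k < p K / 2" if "k \<ge> L\<^sub>0" for k
    by (auto simp: eventually_sequentially)
  define L where "L = max (Suc N) L\<^sub>0"
  have L: "p j \<le> p k / 2" if "k + L \<le> j" for k j
  proof (cases "k < K")
    case True
    then have "p j < p K / 2" "p K \<le> p k" using that L0 antimonoD[OF p(1)] by (auto simp: L_def)
    then show ?thesis by simp
  next
    case False
    then have "k \<notin> bad p 2 N (Suc N)" using K by auto
    then have "2 * p (k + Suc N) \<le> p k" by (simp add: bad_def)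
    moreover have "p j \<le> p (k + Suc N)"
      using that antimonoD[OF p(1)] by (auto simp: L_def)
    ultimately show ?thesis by simp
  qed
  have L1: "L \<ge> 1" by (simp add: L_def)
  have card: "card (bad p 2 N m) < L * 2 ^ m" if m: "m \<ge> 1" for m
  proof (rule ccontr)
    assume ge: "\<not> ?thesis"
    define xs where "xs = sorted_list_of_set (bad p 2 N m)"
    have len: "L * 2 ^ m \<le> length xs" using ge by (simp add: xs_def)
    have set: "set xs = bad p 2 N m" using fin[OF m] by (simp add: xs_def)
    have sorted: "sorted_wrt (<) xs" by (simp add: xs_def)
    have gap: "i + j < length xs \<Longrightarrow> xs ! i + j \<le> xs ! (i + j)" for i j
    proof (induction j)
      case (Suc j)
      then show ?case using sorted_wrt_nth_less[OF sorted, of "i + j" "i + Suc j"] by simp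
    qed simp
    have idx: "L * i < length xs" if "i < 2 ^ m" for i
      using that len L1 by (metis less_le_trans mult_less_cancel1 zero_less_one)
    show False
    proof (rule no_chain[OF m, of "\<lambda>i. xs ! (L * i)"])
      show "xs ! (L * i) \<in> bad p 2 N m" if "i < 2 ^ m" for i
        using idx[OF that] set nth_mem by blast
      show "p (xs ! (L * Suc i)) \<le> p (xs ! (L * i)) / 2" if "Suc i < 2 ^ m" for i
        using gap[of "L * i" L] idx[OF that] by (intro L) (simp add: algebra_simps)
    qed
  qed
  show ?thesis
    unfolding almost_convex_seq_def
  proof (intro exI[of _ "real (2 * L)"] exI[of _ N] conjI allI impI)
    fix m :: nat assume m: "1 \<le> m"
    have "card (bad p 2 N m) < L * 2 ^ m" using card[OF m] .
    also have "\<dots> \<le> L ^ m * 2 ^ m" using m L1 by (simp add: self_le_power)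
    also have "\<dots> = (2 * L) ^ m" by (simp add: power_mult_distrib)
    finally show "real (card (bad p 2 N m)) < real (2 * L) ^ m"
      by (metis of_nat_less_iff of_nat_power)
  qed (use fin L1 N in auto)
qed

section \<open>Integrals of means of level functions\<close>

definition level_integral :: "(real \<Rightarrow> real) \<Rightarrow> (real \<Rightarrow> real) \<Rightarrow> ennreal" where
  "level_integral f d = (\<integral>\<^sup>+s\<in>{0<..}. ennreal (f (d s)) \<partial>lborel)"

definition level_function :: "(real \<Rightarrow> real) \<Rightarrow> bool" where
  "level_function d \<longleftrightarrow> antimono d \<and> range d \<subseteq> {0..1}"

lemma level_function_mem: "level_function d \<Longrightarrow> d s \<in> {0..1}"
  by (auto simp: level_function_def image_subset_iff)

lemma level_function_antimono: "level_function d \<Longrightarrow> s \<le> t \<Longrightarrow> d t \<le> d s"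
  by (auto simp: level_function_def antimono_def)

definition mean :: "nat \<Rightarrow> (nat \<Rightarrow> real) \<Rightarrow> real" where
  "mean n u = (\<Sum>j=1..n. u j) / real n"

lemma mean_mono: "(\<And>j. j \<in> {1..n} \<Longrightarrow> u j \<le> v j) \<Longrightarrow> mean n u \<le> mean n v"
  unfolding mean_def by (intro divide_right_mono sum_mono) auto

lemma mean_const: "n \<ge> 1 \<Longrightarrow> mean n (\<lambda>_. c) = c"
  by (simp add: mean_def)

lemma mean_mem: "n \<ge> 1 \<Longrightarrow> (\<And>j. j \<in> {1..n} \<Longrightarrow> u j \<in> {0..1}) \<Longrightarrow> mean n u \<in> {0..1}"
  using mean_mono[of n u "\<lambda>_. 1"] mean_mono[of n "\<lambda>_. 0" u] by (simp add: mean_const)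

lemma mean_linear: "n \<ge> 1 \<Longrightarrow> mean n (\<lambda>j. c * u j + e) = c * mean n u + e"
  by (simp add: mean_def sum.distrib sum_distrib_left[symmetric] field_simps)

lemma mean_add: "mean n (\<lambda>j. u j + v j) = mean n u + mean n v"
  by (simp add: mean_def sum.distrib add_divide_distrib)

lemma mean_sum: "mean n (\<lambda>j. \<Sum>l\<in>I. v l j) = (\<Sum>l\<in>I. mean n (v l))"
  unfolding mean_def sum_divide_distrib[symmetric] by (subst sum.swap) rule

lemma mean_cmult: "mean n (\<lambda>j. c * u j) = c * mean n u"
  by (simp add: mean_def sum_distrib_left[symmetric])

lemma level_function_mean:
  assumes "n \<ge> 1" "\<And>j. j \<in> {1..n} \<Longrightarrow> level_function (d j)"
  shows "level_function (\<lambda>s. mean n (\<lambda>j. d j s))"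
proof -
  have "d j s \<in> {0..1}" if "j \<in> {1..n}" for j s
    using level_function_mem[OF assms(2)[OF that]] .
  then have "mean n (\<lambda>j. d j s) \<in> {0..1}" for s
    by (intro mean_mem assms) auto
  moreover have "antimono (\<lambda>s. mean n (\<lambda>j. d j s))"
    by (rule antimonoI, rule mean_mono, rule level_function_antimono[OF assms(2)])
  ultimately show ?thesis by (auto simp: level_function_def)
qed

lemma ennreal_mean:
  assumes "n \<ge> 1" "\<And>j. j \<in> {1..n} \<Longrightarrow> u j \<ge> 0"
  shows "ennreal (mean n u) = ennreal (1 / real n) * (\<Sum>j=1..n. ennreal (u j))"
proof -
  have "ennreal (1 / real n) * (\<Sum>j=1..n. ennreal (u j)) = ennreal (1 / real n) * ennreal (\<Sum>j=1..n. u j)"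
    using assms by (subst sum_ennreal) auto
  also have "\<dots> = ennreal (mean n u)"
    using assms by (subst ennreal_mult[symmetric]) (auto intro: sum_nonneg simp: mean_def)
  finally show ?thesis by simp
qed

lemma nn_integral_mean:
  fixes v :: "nat \<Rightarrow> real \<Rightarrow> real"
  assumes n: "n \<ge> 1" and v: "\<And>j s. j \<in> {1..n} \<Longrightarrow> s > 0 \<Longrightarrow> v j s \<ge> 0"
    and meas: "\<And>j. j \<in> {1..n} \<Longrightarrow> v j \<in> borel_measurable borel"
  shows "(\<integral>\<^sup>+s\<in>{0<..}. ennreal (mean n (\<lambda>j. v j s)) \<partial>lborel)
     = ennreal (1 / real n) * (\<Sum>j=1..n. \<integral>\<^sup>+s\<in>{0<..}. ennreal (v j s) \<partial>lborel)"
proof -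
  have m: "(\<lambda>s. ennreal (v j s) * indicator {0<..} s) \<in> borel_measurable lborel" if "j \<in> {1..n}" for j
    using meas[OF that] by (intro borel_measurable_times_ennreal borel_measurable_indicator) auto
  have "(\<integral>\<^sup>+s\<in>{0<..}. ennreal (mean n (\<lambda>j. v j s)) \<partial>lborel)
     = (\<integral>\<^sup>+s. ennreal (1 / real n) * (\<Sum>j=1..n. ennreal (v j s) * indicator {0<..} s) \<partial>lborel)"
  proof (intro nn_integral_cong)
    fix s
    show "ennreal (mean n (\<lambda>j. v j s)) * indicator {0<..} s
        = ennreal (1 / real n) * (\<Sum>j=1..n. ennreal (v j s) * indicator {0<..} s)"
      using ennreal_mean[OF n, of "\<lambda>j. v j s"] v by (cases "s > 0") auto
  qed
  also have "\<dots> = ennreal (1 / real n) * (\<Sum>j=1..n. \<integral>\<^sup>+s\<in>{0<..}. ennreal (v j s) \<partial>lborel)"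
    by (simp only: nn_integral_cmult[OF borel_measurable_sum[OF m]] nn_integral_sum[OF m])
  finally show ?thesis .
qed

lemma ennreal_mean_const: "n \<ge> 1 \<Longrightarrow> R \<ge> 0 \<Longrightarrow> ennreal (1 / real n) * (\<Sum>j=1..n. ennreal R) = ennreal R"
  using ennreal_mean[of n "\<lambda>_. R"] by (simp add: mean_const)

lemma power_interval:
  fixes x u :: real
  assumes x: "0 < x" "x < 1" and u: "0 < u" "u \<le> 1"
  obtains k where "x ^ Suc k < u" "u \<le> x ^ k"
proof -
  have ex: "\<exists>n. x ^ n < u" using x u real_arch_pow_inv by blast
  define n where "n = (LEAST n. x ^ n < u)"
  have n: "x ^ n < u" unfolding n_def using ex by (rule LeastI_ex)
  then obtain k where k: "n = Suc k" using u by (cases n) auto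
  then have "\<not> x ^ k < u" using not_less_Least[of k "\<lambda>n. x ^ n < u"] by (simp add: n_def)
  with n k that show thesis by auto
qed

lemma nn_integral_indicator_Ioc:
  "c \<ge> 0 \<Longrightarrow> (\<integral>\<^sup>+s. ennreal c * indicator {0<..y} s \<partial>lborel) = ennreal (c * max 0 y)"
  by (cases "y \<ge> 0") (auto simp: nn_integral_cmult_indicator ennreal_mult max_def)

lemma ennreal_le_suminf: "f k \<le> (\<Sum>k. f k)" for f :: "nat \<Rightarrow> ennreal"
  using sum_le_suminf[of f "{k}"] by simp

section \<open>Increasing bijections of the unit interval and the upper bound for means\<close>

locale unit_bijection =
  fixes \<Phi> :: "real \<Rightarrow> real"
  assumes bij: "increasing_bijection {0..1} \<Phi>"
begin

lemma mono: "u \<in> {0..1} \<Longrightarrow> v \<in> {0..1} \<Longrightarrow> \<Phi> u \<le> \<Phi> v \<longleftrightarrow> u \<le> v"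
  using bij unfolding increasing_bijection_def by (metis strict_mono_on_less_eq)

lemma img: "\<Phi> ` {0..1} = {0..1}"
  using bij by (simp add: increasing_bijection_def bij_betw_def)

lemma mem: "u \<in> {0..1} \<Longrightarrow> \<Phi> u \<in> {0..1}"
  using img by blast

lemma nonneg: "u \<in> {0..1} \<Longrightarrow> \<Phi> u \<ge> 0"
  using mem by force

lemma zero: "\<Phi> 0 = 0"
proof -
  obtain z where "z \<in> {0..1}" "\<Phi> z = 0" using img by (metis atLeastAtMost_iff imageE order_refl zero_le_one)
  then show ?thesis using mono[of 0 z] nonneg[of 0] by auto
qed

lemma pos: "0 < u \<Longrightarrow> u \<le> 1 \<Longrightarrow> \<Phi> u > 0"
  using mono[of u 0] nonneg[of u] zero by (simp add: not_le[symmetric])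

lemma antimono_seq: "a > 1 \<Longrightarrow> antimono (\<lambda>k. \<Phi> ((1 / a) ^ k))"
  by (intro antimonoI) (simp add: mono power_decreasing power_le_one)

lemma pos_seq: "a > 1 \<Longrightarrow> \<Phi> ((1 / a) ^ k) > 0"
  by (intro pos) (auto simp: power_le_one)

lemma null_seq:
  assumes "a > 1" shows "(\<lambda>k. \<Phi> ((1 / a) ^ k)) \<longlonglongrightarrow> 0"
proof (rule order_tendstoI)
  show "eventually (\<lambda>k. e < \<Phi> ((1 / a) ^ k)) sequentially" if "e < 0" for e
    using pos_seq[OF assms] that by (intro always_eventually) (meson less_trans)
  fix e :: real assume e: "0 < e"
  obtain z where z: "z \<in> {0..1}" "\<Phi> z = min e 1" using img e by (metis atLeastAtMost_iff imageE le_cases min.cobounded2 min_def zero_le_one not_le)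
  then have "z > 0" using zero e by (metis atLeastAtMost_iff less_eq_real_def min_def not_le zero_less_one)
  then have "eventually (\<lambda>k. (1 / a) ^ k < z) sequentially"
    using assms by (intro order_tendstoD(2)[OF LIMSEQ_realpow_zero]) auto
  then show "eventually (\<lambda>k. \<Phi> ((1 / a) ^ k) < e) sequentially"
  proof eventually_elim
    case (elim k)
    then have "\<not> \<Phi> z \<le> \<Phi> ((1 / a) ^ k)" using z assms by (subst mono) (auto simp: power_le_one)
    then show ?case using z by simp
  qed
qed

lemma measurable_level:
  assumes "level_function d" shows "(\<lambda>s. \<Phi> (d s)) \<in> borel_measurable borel"
proof -
  have "mono (\<lambda>s. - \<Phi> (d s))"
    using assms by (intro monoI) (auto simp: level_function_def antimono_def image_subset_iff mono)
  from borel_measurable_uminus[OF borel_measurable_mono[OF this]] show ?thesis by simp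
qed

text \<open>The weak type bound: the integrand is antitone, so its integral over
  \<open>{0<..s}\<close> is at least \<open>s * \<Phi> (d s)\<close>.\<close>

lemma level_integral_ge:
  assumes d: "level_function d" and s: "s > 0" and R: "level_integral \<Phi> d \<le> ennreal R" "R \<ge> 0"
  shows "s * \<Phi> (d s) \<le> R"
proof -
  have rng: "d t \<in> {0..1}" for t using level_function_mem[OF d] .
  have "ennreal (\<Phi> (d s) * s) = (\<integral>\<^sup>+t. ennreal (\<Phi> (d s)) * indicator {0<..s} t \<partial>lborel)"
    using nn_integral_indicator_Ioc[OF nonneg[OF rng], of s s] s by simp
  also have "\<dots> \<le> level_integral \<Phi> d"
    unfolding level_integral_def using d rng
    by (intro nn_integral_mono) (auto simp: indicator_def level_function_def antimono_def mono intro!: ennreal_leI)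
  finally have "ennreal (\<Phi> (d s) * s) \<le> ennreal R" using R by (meson order_trans)
  then show ?thesis using R by (simp add: mult.commute)
qed

lemma nn_integral_mean_level_le:
  assumes n: "n \<ge> 1" and d: "\<And>j. j \<in> {1..n} \<Longrightarrow> level_function (d j)"
    and I: "\<And>j. j \<in> {1..n} \<Longrightarrow> level_integral \<Phi> (d j) \<le> ennreal R" and R: "R \<ge> 0"
  shows "(\<integral>\<^sup>+s\<in>{0<..}. ennreal (mean n (\<lambda>j. \<Phi> (d j s))) \<partial>lborel) \<le> ennreal R"
proof -
  have "(\<integral>\<^sup>+s\<in>{0<..}. ennreal (mean n (\<lambda>j. \<Phi> (d j s))) \<partial>lborel)
     = ennreal (1 / real n) * (\<Sum>j=1..n. level_integral \<Phi> (d j))"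
    unfolding level_integral_def
    by (intro nn_integral_mean n nonneg measurable_level level_function_mem d)
  also have "\<dots> \<le> ennreal (1 / real n) * (\<Sum>j=1..n. ennreal R)"
    using I by (intro mult_left_mono sum_mono) auto
  also have "\<dots> = ennreal R" using n R by (rule ennreal_mean_const)
  finally show ?thesis .
qed

text \<open>Let the mean \<open>e\<close> of the \<open>d j s\<close> be of order
  \<open>x ^ k\<close>. Up to a constant, \<open>\<Phi>\<close> lies above the line
  \<open>a ^ k * p k * (u - e / 2)\<close> at every value \<open>u = d j s\<close>: trivially for
  \<open>u \<le> e / 2\<close>, by doubling up to \<open>x ^ k\<close>, and by almost convexity
  beyond. Averaging over \<open>j\<close> bounds \<open>\<Phi> e\<close> by the mean of the
  \<open>\<Phi> (d j s)\<close>. Only for \<open>s \<le> y k\<close> can some \<open>u\<close> leave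
  the range in which almost convexity helps.\<close>

lemma level_integral_mean_le:
  assumes a: "a > 1" and ac: "almost_convex_seq a (\<lambda>k. \<Phi> ((1 / a) ^ k))"
    and doubling: "D \<ge> 1" "\<forall>t\<in>{0..1}. \<Phi> t \<le> D * \<Phi> (t / 2)"
  shows "\<exists>c>0. \<forall>n\<ge>1. \<forall>R>0. \<forall>d.
    (\<forall>j\<in>{1..n}. level_function (d j) \<and> level_integral \<Phi> (d j) \<le> ennreal R) \<longrightarrow>
    level_integral \<Phi> (\<lambda>s. mean n (\<lambda>j. d j s)) \<le> ennreal (c * R)"
proof -
  define x where "x = 1 / a"
  define p where "p k = \<Phi> (x ^ k)" for k
  have x: "0 < x" "x < 1" using a by (auto simp: x_def)
  have ax: "a * x = 1" using a by (simp add: x_def)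
  have xk: "x ^ k \<in> {0..1}" "x ^ k > 0" for k using x by (auto simp: power_le_one)
  have ppos: "p k > 0" for k unfolding p_def by (intro pos) (use xk in auto)
  have app: "(a ^ k) * (x ^ k) = 1" for k using ax by (simp flip: power_mult_distrib)
  obtain A \<tau> where A: "A \<ge> 1" and \<tau>: "summable (\<lambda>k. x ^ \<tau> k)"
    and good: "\<And>k i. i \<le> \<tau> k \<Longrightarrow> i \<le> k \<Longrightarrow> a ^ i * p k \<le> A * p (k - i)"
    unfolding p_def x_def
    apply (rule almost_convex_seq_backward[OF a antimono_seq[OF a] pos_seq[OF a] ac])
    subgoal for A \<tau> by (rule that[of A \<tau>]; simp add: p_def x_def)
    done
  \<comment> \<open>\<open>h\<close> halvings lead from \<open>x ^ k\<close> to at most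
    \<open>x ^ Suc k / 2\<close>, a lower bound for the \<open>u\<close> above
    \<open>e / 2\<close>.\<close>
  obtain h where h: "2 * a \<le> 2 ^ h"
    using real_arch_pow[of 2 "2 * a"] by (auto intro: less_imp_le)
  have D: "\<Phi> t \<le> D ^ i * \<Phi> (t / 2 ^ i)" if t: "t \<in> {0..1}" for t i
  proof (induction i)
    case (Suc i)
    have "t / 2 ^ i \<in> {0..1}" using t by (auto simp: divide_le_eq intro: order.trans[OF _ one_le_power])
    from doubling(2)[rule_format, OF this] have "D ^ i * \<Phi> (t / 2 ^ i) \<le> D ^ i * (D * \<Phi> (t / 2 ^ Suc i))"
      using doubling(1) by (intro mult_left_mono) (auto simp: field_simps)
    with Suc show ?case by (simp add: field_simps)
  qed simp
  define C where "C = max (D ^ h) (a * A)"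
  have C: "C \<ge> 1" using doubling(1) by (simp add: C_def le_max_iff_disj)
  define S where "S = (\<Sum>k. x ^ \<tau> k)"
  have S: "S \<ge> 0" unfolding S_def using x by (intro suminf_nonneg \<tau>) auto
  define c where "c = 2 * a * C + A * S"
  have c: "c > 0" using a C A S by (auto simp: c_def intro!: add_pos_nonneg)
  show ?thesis
  proof (intro exI[of _ c] conjI allI impI c)
    fix n :: nat and R :: real and d :: "nat \<Rightarrow> real \<Rightarrow> real"
    assume n: "n \<ge> 1" and R: "R > 0"
      and dI: "\<forall>j\<in>{1..n}. level_function (d j) \<and> level_integral \<Phi> (d j) \<le> ennreal R"
    have d: "level_function (d j)" and I: "level_integral \<Phi> (d j) \<le> ennreal R" if "j \<in> {1..n}" for j
      using dI that by auto
    have rng: "d j s \<in> {0..1}" if "j \<in> {1..n}" for j s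
      using level_function_mem[OF d[OF that]] .
    \<comment> \<open>Chosen so that \<open>p k * y k = R * A * x ^ \<tau> k\<close>, which is
      summable in \<open>k\<close>, while for \<open>s > y k\<close> the weak type bound keeps every
      \<open>d j s\<close> within the good range of \<open>k\<close>.\<close>
    define y where "y k = R * A * x ^ \<tau> k / p k" for k
    have y: "y k \<ge> 0" for k using R A x ppos[of k] by (auto simp: y_def)
    have main: "\<Phi> (mean n (\<lambda>j. d j s)) \<le> 2 * a * C * mean n (\<lambda>j. \<Phi> (d j s))"
      if s: "s > 0" "s > y k" and k: "x ^ Suc k < mean n (\<lambda>j. d j s)" "mean n (\<lambda>j. d j s) \<le> x ^ k" for s k
    proof -
      define e where "e = mean n (\<lambda>j. d j s)"
      have e: "e \<in> {0..1}" unfolding e_def using rng n by (intro mean_mem) auto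
      have ek: "x ^ Suc k < e" "e \<le> x ^ k" using k by (auto simp: e_def)
      \<comment> \<open>Subtracting \<open>e / 2\<close> makes the left side nonpositive at small
        values and still leaves half of the mean after averaging.\<close>
      have "a ^ k * p k * (d j s - e / 2) \<le> C * \<Phi> (d j s)" if j: "j \<in> {1..n}" for j
      proof -
        define u where "u = d j s"
        have u: "u \<in> {0..1}" unfolding u_def using rng[OF j] .
        have su: "s * \<Phi> u \<le> R"
          unfolding u_def using R by (intro level_integral_ge d j I s) auto
        have ap: "a ^ k * p k \<ge> 0" using a ppos[of k] by simp
        consider "u \<le> e / 2" | "e / 2 < u" "u \<le> x ^ k" | "x ^ k < u" by linarith
        then have "a ^ k * p k * (u - e / 2) \<le> C * \<Phi> u"
        proof cases
          case 1
          then have "a ^ k * p k * (u - e / 2) \<le> 0"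
            using ap by (intro mult_nonneg_nonpos) auto
          also have "0 \<le> C * \<Phi> u" using C nonneg[OF u] by simp
          finally show ?thesis .
        next
          case 2
          have "a ^ k * p k * (u - e / 2) \<le> a ^ k * p k * x ^ k"
            using 2 e ap by (intro mult_left_mono) auto
          also have "\<dots> = p k" using app[of k] by simp
          also have "\<dots> \<le> D ^ h * \<Phi> (x ^ k / 2 ^ h)" unfolding p_def by (rule D[OF xk(1)])
          also have "\<dots> \<le> D ^ h * \<Phi> u"
          proof -
            have "x ^ k / 2 ^ h \<le> x ^ k / (2 * a)" using h a xk(2)[of k] by (intro divide_left_mono) auto
            also have "\<dots> = x ^ Suc k / 2" by (simp add: x_def)
            also have "\<dots> \<le> u" using 2 ek by simp
            finally have "x ^ k / 2 ^ h \<le> u" .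
            moreover have "x ^ k / 2 ^ h \<in> {0..1}"
              using xk[of k] by (auto simp: divide_le_eq intro: order.trans[OF _ one_le_power])
            ultimately have "\<Phi> (x ^ k / 2 ^ h) \<le> \<Phi> u" using u by (simp only: mono)
            then show ?thesis using doubling(1) by (intro mult_left_mono) auto
          qed
          also have "\<dots> \<le> C * \<Phi> u" using nonneg[OF u] by (intro mult_right_mono) (auto simp: C_def)
          finally show ?thesis .
        next
          case 3
          obtain l where l: "x ^ Suc l < u" "u \<le> x ^ l"
          proof (rule power_interval[OF x, of u])
            show "0 < u" using 3 xk(2)[of k] by simp
            show "u \<le> 1" using u by simp
          qed
          have "x ^ k < x ^ l" using 3 l by simp
          then have "l < k" using x by (simp add: power_strict_decreasing_iff)
          define i where "i = k - Suc l"
          with \<open>l < k\<close> have i: "k = Suc l + i" by simp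
          show ?thesis
          proof (cases "i \<le> \<tau> k")
            case True
            have "p (Suc l) \<le> \<Phi> u" unfolding p_def by (subst mono) (use l u xk(1)[of "Suc l"] in auto)
            have "a ^ k * p k * (u - e / 2) \<le> a ^ k * p k * x ^ l"
              using l e ap by (intro mult_left_mono) auto
            also have "\<dots> = a * (a ^ i * p k) * (a ^ l * x ^ l)"
              by (simp add: i power_add)
            also have "\<dots> \<le> a * (A * p (Suc l))"
              using good[OF True] a by (simp add: app i)
            also have "\<dots> \<le> a * (A * \<Phi> u)"
              using \<open>p (Suc l) \<le> \<Phi> u\<close> a A by (intro mult_left_mono) auto
            also have "\<dots> \<le> C * \<Phi> u"
              unfolding mult.assoc[symmetric] using nonneg[OF u] by (intro mult_right_mono) (auto simp: C_def)
            finally show ?thesis .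
          next
            \<comment> \<open>This case is impossible: \<open>\<Phi> u\<close> is at least
              \<open>a ^ \<tau> k * p k / A\<close>, so \<open>s > y k\<close> would give
              \<open>s * \<Phi> u > R\<close>, against the weak type bound.\<close>
            case False
            then have tk: "\<tau> k \<le> k" using i by simp
            have "x ^ (k - \<tau> k) \<le> x ^ Suc l" using False i x by (intro power_decreasing) auto
            then have "p (k - \<tau> k) \<le> \<Phi> u" unfolding p_def by (subst mono) (use l u xk(1)[of "k - \<tau> k"] in auto)
            then have "a ^ \<tau> k * p k \<le> A * \<Phi> u"
              using good[OF order_refl tk] A by (meson mult_left_mono order_trans zero_le_one)
            then have "a ^ \<tau> k * p k * x ^ \<tau> k \<le> A * \<Phi> u * x ^ \<tau> k"
              using x by (intro mult_right_mono) auto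
            then have "p k \<le> A * \<Phi> u * x ^ \<tau> k"
              using app[of "\<tau> k"] by (simp add: mult.commute mult.left_commute)
            then have "y k * p k * \<Phi> u < s * p k * \<Phi> u"
              using s ppos[of k] u 3 xk[of k] by (intro mult_strict_right_mono pos) auto
            also have "\<dots> \<le> R * p k" using su ppos[of k] by (simp add: mult.commute mult.left_commute)
            also have "\<dots> \<le> R * (A * \<Phi> u * x ^ \<tau> k)"
              using \<open>p k \<le> A * \<Phi> u * x ^ \<tau> k\<close> R by (intro mult_left_mono) auto
            also have "\<dots> = y k * p k * \<Phi> u" using ppos[of k] by (simp add: y_def)
            finally show ?thesis by simp
          qed
        qed
        then show ?thesis by (simp add: u_def)
      qed
      then have "mean n (\<lambda>j. a ^ k * p k * (d j s - e / 2)) \<le> mean n (\<lambda>j. C * \<Phi> (d j s))"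
        by (rule mean_mono)
      also have "(\<lambda>j. a ^ k * p k * (d j s - e / 2)) = (\<lambda>j. (a ^ k * p k) * d j s + - (a ^ k * p k * (e / 2)))"
        by (auto simp: algebra_simps)
      finally have 1: "a ^ k * p k * e \<le> 2 * C * mean n (\<lambda>j. \<Phi> (d j s))"
        unfolding mean_linear[OF n] mean_cmult e_def[symmetric] by (simp add: algebra_simps)
      have "\<Phi> e \<le> p k" unfolding p_def by (subst mono) (use e xk(1)[of k] ek in auto)
      also have "p k = a * (a ^ k * p k * x ^ Suc k)"
        using app[of "Suc k"] by (simp add: mult.commute mult.left_commute)
      also have "\<dots> \<le> a * (a ^ k * p k * e)"
        using ek a ppos[of k] by (intro mult_left_mono) auto
      also have "\<dots> \<le> a * (2 * C * mean n (\<lambda>j. \<Phi> (d j s)))"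
        using 1 a by (intro mult_left_mono) auto
      finally show ?thesis by (simp add: e_def mult_ac)
    qed
    have mem': "mean n (\<lambda>j. d j s) \<in> {0..1}" for s using rng n by (intro mean_mem) auto
    have mn: "mean n (\<lambda>j. \<Phi> (d j s)) \<ge> 0" for s
      using mean_mono[of n "\<lambda>_. 0" "\<lambda>j. \<Phi> (d j s)"] nonneg rng n by (auto simp: mean_const)
    \<comment> \<open>The order \<open>k\<close> of the mean varies with \<open>s\<close>. Instead
      of splitting the domain accordingly, the bounds \<open>p k\<close> on \<open>{0<..y k}\<close>
      are added over all \<open>k\<close>.\<close>
    have ptw: "ennreal (\<Phi> (mean n (\<lambda>j. d j s))) * indicator {0<..} s
      \<le> ennreal (2 * a * C) * (ennreal (mean n (\<lambda>j. \<Phi> (d j s))) * indicator {0<..} s)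
        + (\<Sum>k. ennreal (p k) * indicator {0<..y k} s)" for s
    proof (cases "s > 0 \<and> mean n (\<lambda>j. d j s) > 0")
      case True
      obtain k where k: "x ^ Suc k < mean n (\<lambda>j. d j s)" "mean n (\<lambda>j. d j s) \<le> x ^ k"
      proof (rule power_interval[OF x, of "mean n (\<lambda>j. d j s)"])
        show "0 < mean n (\<lambda>j. d j s)" using True by simp
        show "mean n (\<lambda>j. d j s) \<le> 1" using mem'[of s] by simp
      qed
      show ?thesis
      proof (cases "s > y k")
        case True': True
        have "ennreal (\<Phi> (mean n (\<lambda>j. d j s))) \<le> ennreal (2 * a * C * mean n (\<lambda>j. \<Phi> (d j s)))"
          using main[OF _ True' k] True by (intro ennreal_leI) auto
        also have "\<dots> = ennreal (2 * a * C) * ennreal (mean n (\<lambda>j. \<Phi> (d j s)))"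
          using a C mn by (intro ennreal_mult) auto
        finally show ?thesis using True by (simp add: add_increasing2)
      next
        case False
        have "\<Phi> (mean n (\<lambda>j. d j s)) \<le> p k" unfolding p_def by (subst mono) (use mem'[of s] xk(1)[of k] k in auto)
        then have "ennreal (\<Phi> (mean n (\<lambda>j. d j s))) \<le> ennreal (p k) * indicator {0<..y k} s"
          using False True by (simp add: ennreal_leI)
        also have "\<dots> \<le> (\<Sum>k. ennreal (p k) * indicator {0<..y k} s)"
          by (rule ennreal_le_suminf)
        finally show ?thesis using True by (simp add: add_increasing)
      qed
    next
      case False
      then have "s > 0 \<Longrightarrow> mean n (\<lambda>j. d j s) = 0" using mem'[of s] by auto
      then show ?thesis using zero by (cases "s > 0") auto
    qed
    have meas: "(\<lambda>s. mean n (\<lambda>j. \<Phi> (d j s))) \<in> borel_measurable borel"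
      unfolding mean_def using measurable_level[OF d]
      by (intro borel_measurable_divide borel_measurable_sum borel_measurable_const)
    then have m1: "(\<lambda>s. ennreal (mean n (\<lambda>j. \<Phi> (d j s))) * indicator {0<..} s) \<in> borel_measurable lborel"
      by measurable
    have m2: "(\<lambda>s. ennreal (p k) * indicator {0<..y k} s) \<in> borel_measurable lborel" for k
      by measurable
    have m3: "(\<lambda>s. \<Sum>k. ennreal (p k) * indicator {0<..y k} s) \<in> borel_measurable lborel"
      by measurable
    have "level_integral \<Phi> (\<lambda>s. mean n (\<lambda>j. d j s))
      \<le> (\<integral>\<^sup>+s. ennreal (2 * a * C) * (ennreal (mean n (\<lambda>j. \<Phi> (d j s))) * indicator {0<..} s)
        + (\<Sum>k. ennreal (p k) * indicator {0<..y k} s) \<partial>lborel)"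
      unfolding level_integral_def using ptw by (intro nn_integral_mono)
    also have "\<dots> = ennreal (2 * a * C) * (\<integral>\<^sup>+s\<in>{0<..}. ennreal (mean n (\<lambda>j. \<Phi> (d j s))) \<partial>lborel)
        + (\<Sum>k. \<integral>\<^sup>+s. ennreal (p k) * indicator {0<..y k} s \<partial>lborel)"
      by (subst nn_integral_add[OF borel_measurable_times_ennreal[OF borel_measurable_const m1] m3])
        (simp only: nn_integral_cmult[OF m1] nn_integral_suminf[OF m2])
    also have "(\<lambda>k. \<integral>\<^sup>+s. ennreal (p k) * indicator {0<..y k} s \<partial>lborel) = (\<lambda>k. ennreal (R * A * x ^ \<tau> k))"
    proof
      fix k
      have "p k * y k = R * A * x ^ \<tau> k" using ppos[of k] by (simp add: y_def)
      then show "(\<integral>\<^sup>+s. ennreal (p k) * indicator {0<..y k} s \<partial>lborel) = ennreal (R * A * x ^ \<tau> k)"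
        using y[of k] ppos[of k] by (subst nn_integral_indicator_Ioc) auto
    qed
    also have "(\<Sum>k. ennreal (R * A * x ^ \<tau> k)) = ennreal (R * A * S)"
      unfolding S_def using \<tau> R A x
      by (subst suminf_ennreal2) (auto intro: summable_mult simp: suminf_mult)
    also have "ennreal (2 * a * C) * (\<integral>\<^sup>+s\<in>{0<..}. ennreal (mean n (\<lambda>j. \<Phi> (d j s))) \<partial>lborel)
        + ennreal (R * A * S) \<le> ennreal (2 * a * C) * ennreal R + ennreal (R * A * S)"
      using R by (intro add_mono mult_left_mono nn_integral_mean_level_le n d I) auto
    also have "\<dots> = ennreal (c * R)"
      using R a C A S by (simp add: c_def ennreal_mult[symmetric] ennreal_plus[symmetric] algebra_simps del: ennreal_plus)
    finally show "level_integral \<Phi> (\<lambda>s. mean n (\<lambda>j. d j s)) \<le> ennreal (c * R)" .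
  qed
qed

end

section \<open>The inverse bijection and the lower bound for means\<close>

context unit_bijection
begin

abbreviation \<Psi> :: "real \<Rightarrow> real" where "\<Psi> \<equiv> inv_into {0..1} \<Phi>"

lemma inverse_right: "u \<in> {0..1} \<Longrightarrow> \<Phi> (\<Psi> u) = u"
  using img by (simp add: f_inv_into_f)

lemma inverse_mem: "u \<in> {0..1} \<Longrightarrow> \<Psi> u \<in> {0..1}"
  using img by (metis inv_into_into)

lemma inverse_left: "u \<in> {0..1} \<Longrightarrow> \<Psi> (\<Phi> u) = u"
  using bij by (simp add: increasing_bijection_def bij_betw_def)

lemma unit_bijection_inverse: "unit_bijection \<Psi>"
proof
  have "strict_mono_on {0..1} \<Psi>"
    using mono inverse_right inverse_mem by (intro strict_mono_onI) (metis not_le)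
  moreover have "bij_betw \<Psi> {0..1} {0..1}"
    using bij by (simp add: increasing_bijection_def bij_betw_inv_into)
  ultimately show "increasing_bijection {0..1} \<Psi>"
    by (simp add: increasing_bijection_def)
qed

text \<open>Truncation at \<open>R / s\<close> makes it unnecessary to rescale the functions to equal norms.\<close>

lemma nn_integral_truncated_ge:
  assumes d: "level_function d" and R: "R > 0" "ennreal R \<le> level_integral \<Phi> d"
  shows "ennreal R \<le> (\<integral>\<^sup>+s\<in>{0<..}. ennreal (min (\<Phi> (d s)) (R / s)) \<partial>lborel)"
proof (cases "\<exists>s>0. R / s < \<Phi> (d s)")
  \<comment> \<open>On \<open>{0<..s}\<close> both functions in the minimum are at least
    \<open>R / s\<close>, so this interval alone contributes \<open>R\<close>. If there is no such
    \<open>s\<close>, the truncation changes nothing.\<close>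
  case True
  then obtain s where s: "s > 0" "R / s < \<Phi> (d s)" by blast
  have "ennreal R = (\<integral>\<^sup>+t. ennreal (R / s) * indicator {0<..s} t \<partial>lborel)"
    using nn_integral_indicator_Ioc[of "R / s" s] s R by simp
  also have "\<dots> \<le> (\<integral>\<^sup>+s\<in>{0<..}. ennreal (min (\<Phi> (d s)) (R / s)) \<partial>lborel)"
  proof (intro nn_integral_mono)
    fix t
    have "R / s \<le> min (\<Phi> (d t)) (R / t)" if "0 < t" "t \<le> s"
    proof -
      have "\<Phi> (d s) \<le> \<Phi> (d t)"
        unfolding mono[OF level_function_mem[OF d] level_function_mem[OF d]]
        using that by (intro level_function_antimono[OF d])
      moreover have "R / s \<le> R / t" using that R by (intro divide_left_mono) auto
      ultimately show ?thesis using s by simp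
    qed
    then show "ennreal (R / s) * indicator {0<..s} t \<le> ennreal (min (\<Phi> (d t)) (R / t)) * indicator {0<..} t"
      by (auto simp: indicator_def ennreal_leI)
  qed
  finally show ?thesis .
next
  case False
  then have "level_integral \<Phi> d = (\<integral>\<^sup>+s\<in>{0<..}. ennreal (min (\<Phi> (d s)) (R / s)) \<partial>lborel)"
    unfolding level_integral_def
    by (intro nn_integral_cong) (auto simp: indicator_def min_def)
  with R show ?thesis by simp
qed

text \<open>Let \<open>\<Phi> (D s)\<close> be of order \<open>x ^ k\<close> and a truncated value
  \<open>u\<close> of order \<open>x ^ l\<close>. If \<open>k \<le> l\<close>, then \<open>u\<close>
  is bounded by a multiple of \<open>\<Phi> (D s)\<close>. If \<open>k\<close> is in the good range
  of \<open>l\<close>, it is bounded by a multiple of \<open>\<Phi> (D s) * \<Psi> u / D s\<close>,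
  whose mean is controlled because \<open>\<Psi> u \<le> d j s\<close>. For any other
  \<open>l\<close> the proportion of such \<open>j\<close> is at most \<open>\<delta> l\<close>, and
  they occur only for \<open>s \<le> R * a ^ l\<close>. The integral of these last terms is at most
  \<open>R / 2\<close>, which is absorbed into the left side.\<close>

lemma level_integral_mean_ge:
  assumes a: "a > 1" and ac: "almost_convex_seq a (\<lambda>k. \<Psi> ((1 / a) ^ k))"
  shows "\<exists>c>0. \<forall>n\<ge>1. \<forall>R>0. \<forall>d.
    (\<forall>j\<in>{1..n}. level_function (d j) \<and> ennreal R \<le> level_integral \<Phi> (d j)) \<longrightarrow>
    ennreal R \<le> ennreal c * level_integral \<Phi> (\<lambda>s. mean n (\<lambda>j. d j s))"
proof -
  interpret inv: unit_bijection \<Psi> by (rule unit_bijection_inverse)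
  define x where "x = 1 / a"
  define q where "q k = \<Psi> (x ^ k)" for k
  have x: "0 < x" "x < 1" using a by (auto simp: x_def)
  have ax: "a * x = 1" using a by (simp add: x_def)
  have xk: "x ^ k \<in> {0..1}" "x ^ k > 0" for k using x by (auto simp: power_le_one)
  have qpos: "q k > 0" for k unfolding q_def by (intro inv.pos) (use xk in auto)
  have q_antimono: "q l \<le> q k" if "k \<le> l" for k l
    unfolding q_def using x that xk[of k] xk[of l] by (simp add: inv.mono power_decreasing)
  have app: "(a ^ k) * (x ^ k) = 1" for k using ax by (simp flip: power_mult_distrib)
  \<comment> \<open>The bound \<open>1 / (2 * a)\<close> makes the total error
    \<open>a * R * (\<Sum>l. \<delta> l)\<close> at most \<open>R / 2\<close>.\<close>
  obtain A \<tau> where A: "A \<ge> 1" and \<tau>: "summable (\<lambda>k. q (k + \<tau> k) / q k)"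
    "(\<Sum>k. q (k + \<tau> k) / q k) \<le> 1 / (2 * a)"
    and good: "\<And>k i. i \<le> \<tau> k \<Longrightarrow> a ^ i * q (k + i) \<le> A * q k"
    using a
    apply (atomize_elim)
    apply (rule almost_convex_seq_forward[OF a inv.antimono_seq[OF a] inv.pos_seq[OF a] inv.null_seq[OF a] ac,
        of "1 / (2 * a)"])
    subgoal by simp
    subgoal for A \<tau> unfolding q_def x_def by (intro exI[of _ A] exI[of _ \<tau>]) auto
    done
  define \<delta> where "\<delta> l = q (l + \<tau> l) / q l" for l
  have \<delta>: "\<delta> l \<ge> 0" for l using qpos[of l] qpos[of "l + \<tau> l"] by (simp add: \<delta>_def less_imp_le)
  define C where "C = a\<^sup>2 + a\<^sup>2 * A"
  have C: "C > 0" using a A by (auto simp: C_def intro!: add_pos_nonneg)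
  show ?thesis
  proof (intro exI[of _ "2 * C"] conjI allI impI)
    show "2 * C > 0" using C by simp
    fix n :: nat and R :: real and d :: "nat \<Rightarrow> real \<Rightarrow> real"
    assume n: "n \<ge> 1" and R: "R > 0"
      and dI: "\<forall>j\<in>{1..n}. level_function (d j) \<and> ennreal R \<le> level_integral \<Phi> (d j)"
    have d: "level_function (d j)" and I: "ennreal R \<le> level_integral \<Phi> (d j)" if "j \<in> {1..n}" for j
      using dI that by auto
    define D where "D s = mean n (\<lambda>j. d j s)" for s
    have D: "level_function D" unfolding D_def using n d by (rule level_function_mean)
    \<comment> \<open>A lower bound for the integral gives no weak type bound; the truncation
      supplies \<open>s * u j s \<le> R\<close> instead.\<close>
    define u where "u j s = min (\<Phi> (d j s)) (R / s)" for j s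
    have u: "u j s \<in> {0..1}" "\<Psi> (u j s) \<le> d j s" "s * u j s \<le> R" if "j \<in> {1..n}" "s > 0" for j s
    proof -
      have dm: "d j s \<in> {0..1}" using level_function_mem[OF d[OF that(1)]] .
      show *: "u j s \<in> {0..1}" unfolding u_def using mem[OF dm] that R by (auto simp: min_le_iff_disj)
      have "\<Psi> (u j s) \<le> \<Psi> (\<Phi> (d j s))" using * mem[OF dm] by (simp add: inv.mono u_def)
      then show "\<Psi> (u j s) \<le> d j s" using inverse_left[OF dm] by simp
      have "s * u j s \<le> s * (R / s)" unfolding u_def using that by (intro mult_left_mono) auto
      then show "s * u j s \<le> R" using that by simp
    qed
    have main: "ennreal (mean n (\<lambda>j. u j s)) \<le> ennreal C * ennreal (\<Phi> (D s))
        + (\<Sum>l. ennreal (a * \<delta> l * x ^ l) * indicator {0<..R * a ^ l} s)" if s: "s > 0" for s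
    proof (cases "D s = 0")
      case True
      have nn: "d j s \<ge> 0" if "j \<in> {1..n}" for j using level_function_mem[OF d[OF that]] by auto
      have "(\<Sum>j=1..n. d j s) = 0" using True n by (simp add: D_def mean_def)
      then have "d j s = 0" if "j \<in> {1..n}" for j
        using that nn by (subst (asm) sum_nonneg_eq_0_iff) auto
      then have "mean n (\<lambda>j. u j s) = mean n (\<lambda>j. 0)"
        unfolding mean_def using zero R s by (auto simp: u_def intro!: sum.cong)
      then show ?thesis using n by (simp add: mean_const)
    next
      case False
      have Dm: "D s \<in> {0..1}" "D s > 0" using level_function_mem[OF D, of s] False by auto
      define e where "e = \<Phi> (D s)"
      have e: "0 < e" "e \<le> 1" unfolding e_def using pos[of "D s"] mem[of "D s"] Dm by auto
      obtain k where k: "x ^ Suc k < e" "e \<le> x ^ k" using power_interval[OF x e] .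
      have "D s = \<Psi> e" unfolding e_def using inverse_left[OF Dm(1)] by simp
      also have "\<dots> \<le> q k" unfolding q_def using k e xk[of k] by (subst inv.mono) auto
      finally have Dq: "D s \<le> q k" .
      \<comment> \<open>\<open>a * x ^ l\<close> is the power of \<open>x\<close> with exponent
        \<open>l - 1\<close>, in a form that also covers \<open>l = 0\<close>. The set
        \<open>T\<close> below collects the orders whose good range ends before
        \<open>k\<close>.\<close>
      define lev where "lev l j = (of_bool (x ^ l < u j s \<and> u j s \<le> a * x ^ l) :: real)" for l j
      define T where "T = {l. l < k \<and> l + \<tau> l < k}"
      have fT: "finite T" unfolding T_def by (rule finite_subset[of _ "{..<k}"]) auto
      define E where "E j = (\<Sum>l\<in>T. a * x ^ l * lev l j)" for j
      have E: "E j \<ge> 0" for j unfolding E_def lev_def using a x by (intro sum_nonneg) auto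
      have ptw: "u j s \<le> a\<^sup>2 * e + (a\<^sup>2 * A * e / D s * \<Psi> (u j s) + E j)" if j: "j \<in> {1..n}" for j
      proof (cases "u j s = 0")
        case True
        then show ?thesis using E[of j] e inv.zero by simp
      next
        case False
        note uj = u[OF j s]
        have psi: "\<Psi> (u j s) \<ge> 0" by (rule inv.nonneg[OF uj(1)])
        have B: "a\<^sup>2 * A * e / D s * \<Psi> (u j s) \<ge> 0" using A e Dm psi by simp
        have a2e: "a\<^sup>2 * e \<ge> 0" using e by simp
        obtain l' where l': "x ^ Suc l' < u j s" "u j s \<le> x ^ l'"
          using power_interval[OF x, of "u j s"] uj(1) False by (metis atLeastAtMost_iff less_eq_real_def)
        define l where "l = Suc l'"
        have l: "x ^ l < u j s" "u j s \<le> a * x ^ l"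
          using l' ax by (auto simp: l_def simp flip: mult.assoc)
        consider "k \<le> l" | "l < k" "k \<le> l + \<tau> l" | "l < k" "l + \<tau> l < k" by linarith
        then show ?thesis
        proof cases
          case 1
          have "u j s \<le> a * x ^ k"
            using l 1 a x power_decreasing[of k l x] by (smt (verit) mult_left_mono)
          also have "\<dots> = a\<^sup>2 * x ^ Suc k" using ax by (simp add: power2_eq_square)
          also have "\<dots> \<le> a\<^sup>2 * e" using k by (intro mult_left_mono) auto
          finally show ?thesis using B E[of j] by linarith
        next
          case 2
          define i where "i = k - l"
          have i: "k = l + i" "i \<le> \<tau> l" using 2 by (auto simp: i_def)
          have "a ^ i * D s \<le> a ^ i * q k" using Dq a by (intro mult_left_mono) auto
          also have "\<dots> \<le> A * q l" using good[OF i(2)] i by simp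
          also have "\<dots> \<le> A * \<Psi> (u j s)"
            unfolding q_def using l uj(1) xk[of l] A by (intro mult_left_mono) (auto simp: inv.mono)
          finally have *: "a ^ i \<le> A * \<Psi> (u j s) / D s" using Dm by (simp add: pos_le_divide_eq)
          have "u j s \<le> a * x ^ l * (a ^ i * x ^ i)" using l app[of i] by simp
          also have "\<dots> = a\<^sup>2 * x ^ Suc k * a ^ i"
            using ax by (simp add: i power_add power2_eq_square mult_ac)
          also have "\<dots> \<le> a\<^sup>2 * e * (A * \<Psi> (u j s) / D s)"
            using k a e * x by (intro mult_mono) auto
          also have "\<dots> = a\<^sup>2 * A * e / D s * \<Psi> (u j s)" by simp
          finally show ?thesis using a2e E[of j] by linarith
        next
          case 3
          have "u j s \<le> a * x ^ l * lev l j" using l by (simp add: lev_def)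
          also have "\<dots> \<le> E j"
            unfolding E_def using 3 fT a x by (intro member_le_sum) (auto simp: T_def lev_def)
          finally show ?thesis using a2e B by linarith
        qed
      qed
      have psimean: "mean n (\<lambda>j. \<Psi> (u j s)) \<le> D s"
        unfolding D_def by (rule mean_mono) (rule u(2)[OF _ s])
      have "mean n (\<lambda>j. u j s) \<le> mean n (\<lambda>j. a\<^sup>2 * e + (a\<^sup>2 * A * e / D s * \<Psi> (u j s) + E j))"
        by (rule mean_mono) (rule ptw)
      also have "\<dots> = a\<^sup>2 * e + (a\<^sup>2 * A * e / D s * mean n (\<lambda>j. \<Psi> (u j s)) + mean n E)"
        unfolding mean_add mean_const[OF n] mean_cmult by simp
      also have "a\<^sup>2 * A * e / D s * mean n (\<lambda>j. \<Psi> (u j s)) \<le> a\<^sup>2 * A * e / D s * D s"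
        using psimean A e Dm by (intro mult_left_mono) auto
      also have "\<dots> = a\<^sup>2 * A * e" using Dm by simp
      also have "mean n E = (\<Sum>l\<in>T. a * x ^ l * mean n (lev l))"
        unfolding E_def mean_sum mean_cmult ..
      also have "\<dots> \<le> (\<Sum>l\<in>T. a * \<delta> l * x ^ l * indicator {0<..R * a ^ l} s)"
      proof (intro sum_mono)
        fix l assume "l \<in> T"
        then have l: "l + \<tau> l < k" by (simp add: T_def)
        \<comment> \<open>Markov's inequality: every \<open>j\<close> counted by
          \<open>lev l\<close> has \<open>\<Psi> (u j s) \<ge> q l\<close>, while the mean of these
          values is at most \<open>D s \<le> q k \<le> q (l + \<tau> l)\<close>.\<close>
        have "q l * mean n (lev l) = mean n (\<lambda>j. q l * lev l j)" by (simp add: mean_cmult)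
        also have "\<dots> \<le> mean n (\<lambda>j. \<Psi> (u j s))"
        proof (rule mean_mono)
          fix j assume j: "j \<in> {1..n}"
          show "q l * lev l j \<le> \<Psi> (u j s)"
            using u(1)[OF j s] xk[of l] inv.nonneg[OF u(1)[OF j s]] by (auto simp: lev_def q_def inv.mono)
        qed
        also have "\<dots> \<le> q (l + \<tau> l)" using psimean Dq q_antimono[of "l + \<tau> l" k] l by linarith
        finally have le: "mean n (lev l) \<le> \<delta> l"
          using qpos[of l] by (simp add: \<delta>_def pos_le_divide_eq mult.commute)
        show "a * x ^ l * mean n (lev l) \<le> a * \<delta> l * x ^ l * indicator {0<..R * a ^ l} s"
        proof (cases "s \<le> R * a ^ l")
          case True
          have "a * x ^ l * mean n (lev l) \<le> a * x ^ l * \<delta> l" using le a x by (intro mult_left_mono) auto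
          then show ?thesis using True s by (simp add: mult_ac)
        next
          case False
          \<comment> \<open>Beyond \<open>R * a ^ l\<close> the truncation forces
            \<open>u j s < x ^ l\<close>.\<close>
          have "lev l j = 0" if j: "j \<in> {1..n}" for j
          proof (rule ccontr)
            assume "lev l j \<noteq> 0"
            then have "s * x ^ l \<le> s * u j s" using s by (simp add: lev_def)
            also have "\<dots> \<le> R" using u(3)[OF j s] .
            finally have "s * x ^ l * a ^ l \<le> R * a ^ l" using a by (intro mult_right_mono) auto
            then show False using False app[of l] by (simp add: mult.assoc mult.commute[of "x ^ l"])
          qed
          then have "mean n (lev l) = 0" by (simp add: mean_def)
          then show ?thesis using a x \<delta>[of l] by simp
        qed
      qed
      finally have *: "mean n (\<lambda>j. u j s) \<le> C * e + (\<Sum>l\<in>T. a * \<delta> l * x ^ l * indicator {0<..R * a ^ l} s)"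
        by (simp add: C_def algebra_simps)
      have nn: "0 \<le> a * \<delta> l * x ^ l * indicator {0<..R * a ^ l} s" for l
        using a \<delta>[of l] x by simp
      have "ennreal (mean n (\<lambda>j. u j s)) \<le> ennreal (C * e + (\<Sum>l\<in>T. a * \<delta> l * x ^ l * indicator {0<..R * a ^ l} s))"
        by (rule ennreal_leI[OF *])
      also have "\<dots> = ennreal C * ennreal e + ennreal (\<Sum>l\<in>T. a * \<delta> l * x ^ l * indicator {0<..R * a ^ l} s)"
        using C e by (subst ennreal_plus) (auto intro!: sum_nonneg nn simp: ennreal_mult)
      also have "ennreal (\<Sum>l\<in>T. a * \<delta> l * x ^ l * indicator {0<..R * a ^ l} s)
          = (\<Sum>l\<in>T. ennreal (a * \<delta> l * x ^ l) * indicator {0<..R * a ^ l} s)"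
        unfolding sum_ennreal[OF nn, symmetric] by (intro sum.cong) (auto simp: indicator_def)
      also have "\<dots> \<le> (\<Sum>l. ennreal (a * \<delta> l * x ^ l) * indicator {0<..R * a ^ l} s)"
        by (rule sum_le_suminf) (auto simp: fT)
      finally show ?thesis by (simp add: e_def)
    qed
    have mu: "u j \<in> borel_measurable borel" if "j \<in> {1..n}" for j
    proof -
      have "(\<lambda>s. R / s) \<in> borel_measurable borel" by measurable
      then show ?thesis
        unfolding u_def using measurable_level[OF d[OF that]] by (intro borel_measurable_min)
    qed
    have "ennreal R = ennreal (1 / real n) * (\<Sum>j=1..n. ennreal R)"
      using n R by (simp only: ennreal_mean_const less_imp_le)
    also have "\<dots> \<le> ennreal (1 / real n) * (\<Sum>j=1..n. \<integral>\<^sup>+s\<in>{0<..}. ennreal (u j s) \<partial>lborel)"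
      unfolding u_def by (intro mult_left_mono sum_mono nn_integral_truncated_ge d R I) auto
    also have "\<dots> = (\<integral>\<^sup>+s\<in>{0<..}. ennreal (mean n (\<lambda>j. u j s)) \<partial>lborel)"
      by (rule nn_integral_mean[symmetric, OF n]) (use u(1) mu in auto)
    also have "\<dots> \<le> (\<integral>\<^sup>+s. ennreal C * (ennreal (\<Phi> (D s)) * indicator {0<..} s)
        + (\<Sum>l. ennreal (a * \<delta> l * x ^ l) * indicator {0<..R * a ^ l} s) \<partial>lborel)"
      using main by (intro nn_integral_mono) (auto simp: indicator_def)
    also have "\<dots> = ennreal C * level_integral \<Phi> D
        + (\<Sum>l. \<integral>\<^sup>+s. ennreal (a * \<delta> l * x ^ l) * indicator {0<..R * a ^ l} s \<partial>lborel)"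
    proof -
      have m1: "(\<lambda>s. ennreal (\<Phi> (D s)) * indicator {0<..} s) \<in> borel_measurable lborel"
        using measurable_level[OF D] by measurable
      have m2: "(\<lambda>s. ennreal (a * \<delta> l * x ^ l) * indicator {0<..R * a ^ l} s) \<in> borel_measurable lborel" for l
        by measurable
      have m3: "(\<lambda>s. \<Sum>l. ennreal (a * \<delta> l * x ^ l) * indicator {0<..R * a ^ l} s) \<in> borel_measurable lborel"
        by measurable
      show ?thesis
        unfolding level_integral_def
        by (subst nn_integral_add[OF borel_measurable_times_ennreal[OF borel_measurable_const m1] m3])
          (simp only: nn_integral_cmult[OF m1] nn_integral_suminf[OF m2])
    qed
    also have "(\<lambda>l. \<integral>\<^sup>+s. ennreal (a * \<delta> l * x ^ l) * indicator {0<..R * a ^ l} s \<partial>lborel) = (\<lambda>l. ennreal (a * R * \<delta> l))"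
    proof
      fix l
      have "a * \<delta> l * x ^ l * (R * a ^ l) = a * R * \<delta> l * (a ^ l * x ^ l)" by simp
      also have "\<dots> = a * R * \<delta> l" by (simp add: app)
      finally show "(\<integral>\<^sup>+s. ennreal (a * \<delta> l * x ^ l) * indicator {0<..R * a ^ l} s \<partial>lborel) = ennreal (a * R * \<delta> l)"
        using a x R \<delta>[of l] by (subst nn_integral_indicator_Ioc) auto
    qed
    also have "(\<Sum>l. ennreal (a * R * \<delta> l)) = ennreal (a * R * (\<Sum>l. \<delta> l))"
      using \<tau>(1) R a \<delta> unfolding \<delta>_def[symmetric]
      by (subst suminf_ennreal2) (auto intro: summable_mult simp: suminf_mult)
    also have "\<dots> \<le> ennreal (R / 2)"
    proof (rule ennreal_leI)
      have "a * R * (\<Sum>l. \<delta> l) \<le> a * R * (1 / (2 * a))"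
        using \<tau>(2) a R unfolding \<delta>_def[symmetric] by (intro mult_left_mono) auto
      then show "a * R * (\<Sum>l. \<delta> l) \<le> R / 2" using a by simp
    qed
    finally have fin: "ennreal R \<le> ennreal C * level_integral \<Phi> D + ennreal (R / 2)"
      by (simp add: add_left_mono)
    have "ennreal R \<le> ennreal (2 * C) * level_integral \<Phi> D"
    proof (cases "level_integral \<Phi> D" rule: ennreal_cases)
      case (real v)
      have "ennreal R \<le> ennreal (C * v + R / 2)"
        using fin R C real by (simp add: ennreal_mult ennreal_plus)
      then have "R \<le> C * v + R / 2" using C real R by (subst (asm) ennreal_le_iff) auto
      then have "R \<le> 2 * C * v" by simp
      then show ?thesis using real C by (simp add: ennreal_mult[symmetric] ennreal_leI)
    next
      case top
      then show ?thesis using C by (simp add: ennreal_mult_top)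
    qed
    then show "ennreal R \<le> ennreal (2 * C) * level_integral \<Phi> (\<lambda>s. mean n (\<lambda>j. d j s))"
      by (simp add: D_def[abs_def])
  qed
qed

end

section \<open>Test functions built from chains of exceptional indices\<close>

lemma mean_lessThan: "mean n u = (\<Sum>i<n. u (Suc i)) / real n"
  unfolding mean_def by (simp add: sum.atLeast1_atMost_eq)

lemma halving_chain:
  fixes t :: "nat \<Rightarrow> real"
  assumes "\<And>i. Suc i < n \<Longrightarrow> t (Suc i) \<le> t i / 2" "i + k < n"
  shows "t (i + k) \<le> t i * (1 / 2) ^ k"
  using assms(2)
proof (induction k)
  case (Suc k)
  then show ?case using assms(1)[of "i + k"] by simp
qed simp

lemma halving_sum_le:
  fixes t :: "nat \<Rightarrow> real"
  assumes t: "\<And>i. Suc i < n \<Longrightarrow> t (Suc i) \<le> t i / 2" and t0: "t j \<ge> 0"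
  shows "(\<Sum>i=j..<n. t i) \<le> 2 * t j"
proof -
  have "(\<Sum>i=j..<n. t i) \<le> (\<Sum>i=j..<n. t j * (1 / 2) ^ (i - j))"
  proof (rule sum_mono)
    fix i assume "i \<in> {j..<n}"
    then show "t i \<le> t j * (1 / 2) ^ (i - j)"
      using halving_chain[of n t j "i - j"] t by simp
  qed
  also have "\<dots> = t j * (\<Sum>i<n - j. (1 / 2) ^ i)"
    unfolding sum_distrib_left by (rule sum.reindex_bij_witness[of _ "\<lambda>i. i + j" "\<lambda>i. i - j"]) auto
  also have "\<dots> \<le> t j * 2"
    using t0 by (intro mult_left_mono) (simp_all add: sum_gp_strict)
  finally show ?thesis by (simp add: mult.commute)
qed

context unit_bijection
begin

text \<open>The bound is tested on a chain of \<open>n = 2 ^ m\<close> exceptional indices. For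
  \<open>s\<close> between \<open>H j / 2\<close> and \<open>H j\<close> the mean is at least
  \<open>t j / n\<close>, and division by \<open>2 ^ m\<close> is a shift of the index by
  \<open>m\<close>. Exceptionality then makes each of these intervals contribute at least
  \<open>2 ^ N\<^sub>0 / n\<close>. They are disjoint because the \<open>H j\<close> at least
  double, so the integral is at least \<open>2 ^ N\<^sub>0\<close>, which exceeds
  \<open>c\<close>.\<close>

lemma almost_convex_if_mean_le:
  assumes bound: "\<And>n H t. n \<ge> 1 \<Longrightarrow> (\<And>j. j \<in> {1..n} \<Longrightarrow> 0 < t j \<and> t j \<le> 1 \<and> 0 < H j \<and> H j * \<Phi> (t j) = 1) \<Longrightarrow>
      level_integral \<Phi> (\<lambda>s. mean n (\<lambda>j. t j * indicator {..<H j} s)) \<le> ennreal c"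
  shows "almost_convex_seq 2 (\<lambda>k. \<Phi> ((1 / 2) ^ k))"
proof -
  define p where "p k = \<Phi> ((1 / 2) ^ k)" for k :: nat
  have half: "(1 / 2 :: real) ^ k \<in> {0..1}" "(1 / 2 :: real) ^ k > 0" for k by (auto simp: power_le_one)
  have ppos: "p k > 0" for k unfolding p_def by (rule pos_seq) simp
  obtain N\<^sub>0 where N0: "max c 0 < 2 ^ N\<^sub>0" using real_arch_pow[of 2 "max c 0"] by auto
  \<comment> \<open>The additional factor 2 in passing to \<open>Suc N\<^sub>0\<close> pays for
    integrating only over the upper half of each interval up to \<open>H j\<close>.\<close>
  have "almost_convex_seq 2 p"
  proof (rule almost_convex_seqI[of _ "Suc N\<^sub>0"])
    show "antimono p" unfolding p_def by (rule antimono_seq) simp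
    show "p \<longlonglongrightarrow> 0" unfolding p_def by (rule null_seq) simp
    fix m :: nat and \<kappa> :: "nat \<Rightarrow> nat" assume "m \<ge> 1"
      and \<kappa>: "\<And>i. i < 2 ^ m \<Longrightarrow> \<kappa> i \<in> bad p 2 (Suc N\<^sub>0) m"
      and chain: "\<And>i. Suc i < 2 ^ m \<Longrightarrow> p (\<kappa> (Suc i)) \<le> p (\<kappa> i) / 2"
    define n :: nat where "n = 2 ^ m"
    define t where "t j = (1 / 2 :: real) ^ \<kappa> (j - 1)" for j
    define H where "H j = 1 / p (\<kappa> (j - 1))" for j
    have n: "n \<ge> 1" by (simp add: n_def)
    have Hpos: "H j > 0" for j using ppos by (simp add: H_def)
    have H2: "2 * H i \<le> H j" if "1 \<le> i" "i < j" "j \<le> n" for i j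
    proof -
      have *: "j - 1 = (i - 1) + (j - i)" using that by simp
      have "p (\<kappa> (j - 1)) \<le> p (\<kappa> (i - 1)) * (1 / 2) ^ (j - i)"
        unfolding * using halving_chain[of n "\<lambda>i. p (\<kappa> i)" "i - 1" "j - i"] chain that by (simp add: n_def)
      also have "\<dots> \<le> p (\<kappa> (i - 1)) * (1 / 2) ^ 1"
        using that ppos[of "\<kappa> (i - 1)"] by (intro mult_left_mono power_decreasing) auto
      finally show ?thesis using ppos[of "\<kappa> (i - 1)"] ppos[of "\<kappa> (j - 1)"] by (simp add: H_def field_simps)
    qed
    have ptw: "(\<Sum>j=1..n. ennreal (p (\<kappa> (j - 1) + m)) * indicator {H j / 2<..<H j} s)
        \<le> ennreal (\<Phi> (mean n (\<lambda>j. t j * indicator {..<H j} s))) * indicator {0<..} s" for s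
    proof (cases "\<exists>j\<in>{1..n}. s \<in> {H j / 2<..<H j}")
      case True
      then obtain j where j: "j \<in> {1..n}" "s \<in> {H j / 2<..<H j}" by blast
      have other: "s \<notin> {H i / 2<..<H i}" if "i \<in> {1..n}" "i \<noteq> j" for i
        using H2[of i j] H2[of j i] that j by (cases "i < j") auto
      have "(\<Sum>i=1..n. ennreal (p (\<kappa> (i - 1) + m)) * indicator {H i / 2<..<H i} s)
          = (\<Sum>i\<in>{j}. ennreal (p (\<kappa> (i - 1) + m)) * indicator {H i / 2<..<H i} s)"
        using j other by (intro sum.mono_neutral_right) (auto simp: indicator_def)
      also have "\<dots> = ennreal (p (\<kappa> (j - 1) + m))" using j by simp
      also have "\<dots> \<le> ennreal (\<Phi> (mean n (\<lambda>j. t j * indicator {..<H j} s)))"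
      proof (rule ennreal_leI)
        have "t j * indicator {..<H j} s \<le> (\<Sum>j=1..n. t j * indicator {..<H j} s)"
          using j by (intro member_le_sum) (auto simp: t_def)
        then have "t j / n \<le> mean n (\<lambda>j. t j * indicator {..<H j} s)"
          unfolding mean_def using j by (intro divide_right_mono) auto
        moreover have "t j / n = (1 / 2) ^ (\<kappa> (j - 1) + m)"
          by (simp add: t_def n_def power_add power_one_over field_simps)
        moreover have "mean n (\<lambda>j. t j * indicator {..<H j} s) \<in> {0..1}"
          using half n by (intro mean_mem) (auto simp: t_def indicator_def)
        ultimately show "p (\<kappa> (j - 1) + m) \<le> \<Phi> (mean n (\<lambda>j. t j * indicator {..<H j} s))"
          unfolding p_def by (subst mono) (use half in auto)
      qed
      moreover have "s > 0" using j Hpos[of j] by auto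
      ultimately show ?thesis by simp
    next
      case False
      then have "(\<Sum>j=1..n. ennreal (p (\<kappa> (j - 1) + m)) * indicator {H j / 2<..<H j} s) = 0"
        by (intro sum.neutral) (auto simp: indicator_def)
      then show ?thesis by simp
    qed
    have "ennreal (2 ^ N\<^sub>0) = (\<Sum>j=1..n. ennreal (2 ^ N\<^sub>0 / 2 ^ m))"
      by (simp add: n_def ennreal_of_nat_eq_real_of_nat ennreal_mult[symmetric])
    also have "\<dots> \<le> (\<Sum>j=1..n. \<integral>\<^sup>+s. ennreal (p (\<kappa> (j - 1) + m)) * indicator {H j / 2<..<H j} s \<partial>lborel)"
    proof (rule sum_mono)
      fix j assume "j \<in> {1..n}"
      then have "2 ^ Suc N\<^sub>0 * p (\<kappa> (j - 1)) < 2 ^ m * p (\<kappa> (j - 1) + m)"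
        using \<kappa>[of "j - 1"] by (auto simp: bad_def n_def)
      then have "2 ^ N\<^sub>0 / 2 ^ m \<le> p (\<kappa> (j - 1) + m) * (H j / 2)"
        using ppos[of "\<kappa> (j - 1)"] by (simp add: H_def field_simps)
      then have "ennreal (2 ^ N\<^sub>0 / 2 ^ m) \<le> ennreal (p (\<kappa> (j - 1) + m)) * ennreal (H j / 2)"
        using ppos[of "\<kappa> (j - 1) + m"] Hpos[of j] by (simp add: ennreal_mult[symmetric] ennreal_leI)
      then show "ennreal (2 ^ N\<^sub>0 / 2 ^ m)
          \<le> (\<integral>\<^sup>+s. ennreal (p (\<kappa> (j - 1) + m)) * indicator {H j / 2<..<H j} s \<partial>lborel)"
        using Hpos[of j] by (simp add: nn_integral_cmult_indicator)
    qed
    also have "\<dots> = (\<integral>\<^sup>+s. (\<Sum>j=1..n. ennreal (p (\<kappa> (j - 1) + m)) * indicator {H j / 2<..<H j} s) \<partial>lborel)"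
      by (rule nn_integral_sum[symmetric]) measurable
    also have "\<dots> \<le> level_integral \<Phi> (\<lambda>s. mean n (\<lambda>j. t j * indicator {..<H j} s))"
      unfolding level_integral_def by (intro nn_integral_mono ptw)
    also have "\<dots> \<le> ennreal c"
      using half ppos by (intro bound n) (auto simp: t_def H_def p_def[symmetric] ppos[THEN less_imp_neq, THEN not_sym])
    finally have "ennreal (2 ^ N\<^sub>0) \<le> ennreal c" .
    then have "2 ^ N\<^sub>0 \<le> max c 0" by (auto simp: ennreal_le_iff2)
    with N0 show False by (meson not_le)
  qed (use ppos in auto)
  then show ?thesis by (simp add: p_def[abs_def])
qed

text \<open>Only \<open>n = 2 ^ (m - N\<^sub>0)\<close> members of a chain are used. The steps that
  reach above a level \<open>s\<close> add up to at most twice the first of them, as the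
  \<open>t j\<close> at least halve. So the mean is at most
  \<open>2 * q (\<kappa> i) / n \<le> q (\<kappa> i + m)\<close>, at which \<open>\<Phi>\<close> has
  the value \<open>(1 / 2) ^ (\<kappa> i + m)\<close>. Integrated up to
  \<open>2 ^ \<kappa> i\<close> this gives \<open>(1 / 2) ^ m\<close> for each step, and
  \<open>(1 / 2) ^ N\<^sub>0 < c\<close> for all of them.\<close>

lemma almost_convex_inverse_if_mean_ge:
  assumes bound: "\<And>n H t. n \<ge> 1 \<Longrightarrow> (\<And>j. j \<in> {1..n} \<Longrightarrow> 0 < t j \<and> t j \<le> 1 \<and> 0 < H j \<and> H j * \<Phi> (t j) = 1) \<Longrightarrow>
      ennreal c \<le> level_integral \<Phi> (\<lambda>s. mean n (\<lambda>j. t j * indicator {..<H j} s))"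
    and c: "c > 0"
  shows "almost_convex_seq 2 (\<lambda>k. \<Psi> ((1 / 2) ^ k))"
proof -
  interpret inv: unit_bijection \<Psi> by (rule unit_bijection_inverse)
  define q where "q k = \<Psi> ((1 / 2) ^ k)" for k :: nat
  have half: "(1 / 2 :: real) ^ k \<in> {0..1}" "(1 / 2 :: real) ^ k > 0" for k by (auto simp: power_le_one)
  have qpos: "q k > 0" for k unfolding q_def by (rule inv.pos_seq) simp
  have q1: "q k \<in> {0..1}" for k unfolding q_def by (rule inv.mem[OF half(1)])
  have anti: "antimono q" unfolding q_def by (rule inv.antimono_seq) simp
  have \<Phi>q: "\<Phi> (q k) = (1 / 2) ^ k" for k unfolding q_def by (rule inverse_right[OF half(1)])
  obtain N\<^sub>0 where N0: "(1 / 2) ^ N\<^sub>0 < c" using real_arch_pow_inv[of c "1 / 2"] c by auto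
  have "almost_convex_seq 2 q"
  proof (rule almost_convex_seqI[of _ "Suc N\<^sub>0"])
    show "antimono q" by (rule anti)
    show "q \<longlonglongrightarrow> 0" unfolding q_def by (rule inv.null_seq) simp
    fix m :: nat and \<kappa> :: "nat \<Rightarrow> nat" assume "m \<ge> 1"
      and \<kappa>: "\<And>i. i < 2 ^ m \<Longrightarrow> \<kappa> i \<in> bad q 2 (Suc N\<^sub>0) m"
      and chain: "\<And>i. Suc i < 2 ^ m \<Longrightarrow> q (\<kappa> (Suc i)) \<le> q (\<kappa> i) / 2"
    \<comment> \<open>For \<open>m \<le> N\<^sub>0\<close> monotonicity of \<open>q\<close> excludes
      exceptional indices. So \<open>m - N\<^sub>0\<close> is a true difference of natural
      numbers.\<close>
    have m: "Suc N\<^sub>0 \<le> m"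
    proof (rule ccontr)
      assume "\<not> ?thesis"
      then have "2 ^ m * q (\<kappa> 0 + m) \<le> 2 ^ Suc N\<^sub>0 * q (\<kappa> 0)"
        using qpos[of "\<kappa> 0 + m"] antimonoD[OF anti, of "\<kappa> 0" "\<kappa> 0 + m"]
        by (intro mult_mono power_increasing) auto
      then show False using \<kappa>[of 0] by (simp add: bad_def)
    qed
    define n :: nat where "n = 2 ^ (m - N\<^sub>0)"
    have n: "n \<ge> 1" "n \<le> 2 ^ m" by (auto simp: n_def intro: power_increasing)
    have nm: "real n * 2 ^ N\<^sub>0 = 2 ^ m" using m by (simp add: n_def flip: power_add)
    define t where "t j = q (\<kappa> (j - 1))" for j
    define H where "H j = (2 :: real) ^ \<kappa> (j - 1)" for j
    have t_chain: "t (Suc (Suc i)) \<le> t (Suc i) / 2" if "Suc i < n" for i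
      using chain[of i] that n by (simp add: t_def)
    have ptw: "ennreal (\<Phi> (mean n (\<lambda>j. t j * indicator {..<H j} s))) * indicator {0<..} s
        \<le> (\<Sum>j=1..n. ennreal ((1 / 2) ^ (\<kappa> (j - 1) + m)) * indicator {0<..H j} s)" for s
    proof (cases "s > 0 \<and> (\<exists>i<n. s < H (Suc i))")
      case True
      define i where "i = (LEAST i. i < n \<and> s < H (Suc i))"
      have i: "i < n" "s < H (Suc i)" using True LeastI_ex[of "\<lambda>i. i < n \<and> s < H (Suc i)"] by (auto simp: i_def)
      have least: "\<not> s < H (Suc k)" if "k < i" for k
        using not_less_Least[of k "\<lambda>i. i < n \<and> s < H (Suc i)"] that i by (auto simp: i_def)
      have "(\<Sum>k<n. t (Suc k) * indicator {..<H (Suc k)} s) = (\<Sum>k=i..<n. t (Suc k) * indicator {..<H (Suc k)} s)"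
        using least by (intro sum.mono_neutral_right) (auto simp: indicator_def not_le)
      also have "\<dots> \<le> (\<Sum>k=i..<n. t (Suc k))"
        using qpos by (intro sum_mono) (auto simp: t_def indicator_def less_imp_le)
      also have "\<dots> \<le> 2 * t (Suc i)"
        using t_chain qpos[of "\<kappa> i"] by (intro halving_sum_le) (auto simp: t_def)
      finally have "mean n (\<lambda>j. t j * indicator {..<H j} s) \<le> 2 * q (\<kappa> i) / n"
        unfolding mean_lessThan by (intro divide_right_mono) (auto simp: t_def)
      also have "2 * q (\<kappa> i) / n \<le> q (\<kappa> i + m)"
      proof -
        have "2 ^ Suc N\<^sub>0 * q (\<kappa> i) < 2 ^ m * q (\<kappa> i + m)"
          using \<kappa>[of i] i n by (simp add: bad_def)
        then have "2 ^ N\<^sub>0 * (2 * q (\<kappa> i)) < 2 ^ N\<^sub>0 * (n * q (\<kappa> i + m))"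
          unfolding nm[symmetric] by (simp add: mult_ac)
        then show ?thesis using n by (simp add: pos_divide_le_eq mult.commute)
      qed
      finally have "mean n (\<lambda>j. t j * indicator {..<H j} s) \<le> q (\<kappa> i + m)" .
      moreover have "mean n (\<lambda>j. t j * indicator {..<H j} s) \<in> {0..1}"
        using q1 n by (intro mean_mem) (auto simp: t_def indicator_def)
      ultimately have "\<Phi> (mean n (\<lambda>j. t j * indicator {..<H j} s)) \<le> (1 / 2) ^ (\<kappa> i + m)"
        unfolding \<Phi>q[symmetric] using q1 by (subst mono) auto
      then have "ennreal (\<Phi> (mean n (\<lambda>j. t j * indicator {..<H j} s))) * indicator {0<..} s
          \<le> ennreal ((1 / 2) ^ (\<kappa> (Suc i - 1) + m)) * indicator {0<..H (Suc i)} s"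
        using True i by (simp add: ennreal_leI)
      also have "\<dots> \<le> (\<Sum>j=1..n. ennreal ((1 / 2) ^ (\<kappa> (j - 1) + m)) * indicator {0<..H j} s)"
        using i by (intro member_le_sum) auto
      finally show ?thesis .
    next
      case False
      have "mean n (\<lambda>j. t j * indicator {..<H j} s) = 0" if "s > 0"
        unfolding mean_lessThan using False that by (auto simp: indicator_def)
      then show ?thesis using zero by (cases "s > 0") auto
    qed
    have "ennreal c \<le> level_integral \<Phi> (\<lambda>s. mean n (\<lambda>j. t j * indicator {..<H j} s))"
      using q1 qpos by (intro bound n) (auto simp: t_def H_def \<Phi>q power_one_over)
    also have "\<dots> \<le> (\<integral>\<^sup>+s. (\<Sum>j=1..n. ennreal ((1 / 2) ^ (\<kappa> (j - 1) + m)) * indicator {0<..H j} s) \<partial>lborel)"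
      unfolding level_integral_def by (intro nn_integral_mono ptw)
    also have "\<dots> = (\<Sum>j=1..n. \<integral>\<^sup>+s. ennreal ((1 / 2) ^ (\<kappa> (j - 1) + m)) * indicator {0<..H j} s \<partial>lborel)"
      by (rule nn_integral_sum) measurable
    also have "\<dots> = (\<Sum>j=1..n. ennreal ((1 / 2) ^ m))"
    proof (rule sum.cong)
      fix j
      have "(1 / 2) ^ (\<kappa> (j - 1) + m) * max 0 (H j) = (1 / 2 :: real) ^ m"
        by (simp add: H_def power_add power_one_over)
      then show "(\<integral>\<^sup>+s. ennreal ((1 / 2) ^ (\<kappa> (j - 1) + m)) * indicator {0<..H j} s \<partial>lborel) = ennreal ((1 / 2) ^ m)"
        by (subst nn_integral_indicator_Ioc) auto
    qed simp
    also have "\<dots> = ennreal (real n * (1 / 2) ^ m)"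
      by (simp add: ennreal_of_nat_eq_real_of_nat ennreal_mult[symmetric])
    also have "real n * (1 / 2) ^ m = (1 / 2) ^ N\<^sub>0"
      using nm by (simp add: power_one_over field_simps)
    finally have "c \<le> (1 / 2) ^ N\<^sub>0" by (subst (asm) ennreal_le_iff) auto
    with N0 show False by simp
  qed (use qpos in auto)
  then show ?thesis by (simp add: q_def[abs_def])
qed

end

section \<open>The Lorentz norm as an integral over levels\<close>

lemma ennreal_powr_ennreal: "y \<ge> 0 \<Longrightarrow> ennreal_powr (ennreal y) p = ennreal (y powr p)"
  by (simp add: ennreal_powr_def)

lemma ennreal_powr_le_iff:
  assumes "p > 0" "y \<ge> 0"
  shows "ennreal_powr v p \<le> ennreal y \<longleftrightarrow> v \<le> ennreal (y powr (1 / p))"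
proof (cases v rule: ennreal_cases)
  case (real w)
  have "w powr p \<le> y \<longleftrightarrow> w \<le> y powr (1 / p)"
  proof
    assume "w powr p \<le> y"
    then have "(w powr p) powr (1 / p) \<le> y powr (1 / p)" using assms by (intro powr_mono2) auto
    then show "w \<le> y powr (1 / p)" using assms real by (simp add: powr_powr)
  next
    assume "w \<le> y powr (1 / p)"
    then have "w powr p \<le> (y powr (1 / p)) powr p" using assms real by (intro powr_mono2) auto
    then show "w powr p \<le> y" using assms by (simp add: powr_powr)
  qed
  then show ?thesis using real assms by (simp add: ennreal_powr_ennreal)
qed (simp add: ennreal_powr_def top_unique)

lemma ennreal_le_powr_iff:
  assumes "p > 0" "y \<ge> 0"
  shows "ennreal y \<le> ennreal_powr v p \<longleftrightarrow> ennreal (y powr (1 / p)) \<le> v"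
proof (cases v rule: ennreal_cases)
  case (real w)
  have "y \<le> w powr p \<longleftrightarrow> y powr (1 / p) \<le> w"
  proof
    assume "y \<le> w powr p"
    then have "y powr (1 / p) \<le> (w powr p) powr (1 / p)" using assms by (intro powr_mono2) auto
    then show "y powr (1 / p) \<le> w" using assms real by (simp add: powr_powr)
  next
    assume "y powr (1 / p) \<le> w"
    then have "(y powr (1 / p)) powr p \<le> w powr p" using assms real by (intro powr_mono2) auto
    then show "y \<le> w powr p" using assms by (simp add: powr_powr)
  qed
  then show ?thesis using real assms by (simp add: ennreal_powr_ennreal)
qed (simp add: ennreal_powr_def)

lemma ennreal_less_powr_iff:
  assumes "p > 0" "y \<ge> 0"
  shows "ennreal y < ennreal_powr v p \<longleftrightarrow> ennreal (y powr (1 / p)) < v"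
  using ennreal_powr_le_iff[OF assms] by (metis not_le)

text \<open>\<open>g t\<close> is the length of the set of all \<open>s > 0\<close> with
  \<open>s < g t\<close>, also when it is infinite; the two integrations are then exchanged.\<close>

lemma nn_integral_layer_cake:
  fixes g :: "'a \<Rightarrow> ennreal"
  assumes "sigma_finite_measure M" and g[measurable]: "g \<in> borel_measurable M"
  shows "(\<integral>\<^sup>+t. g t \<partial>M) = (\<integral>\<^sup>+s\<in>{0<..}. emeasure M {t \<in> space M. ennreal s < g t} \<partial>lborel)"
proof -
  interpret pair_sigma_finite M lborel
    using assms(1) by (simp add: pair_sigma_finite_def lborel.sigma_finite_measure_axioms)
  have slice: "g t = (\<integral>\<^sup>+s. indicator {s. 0 < s \<and> ennreal s < g t} s \<partial>lborel)" for t
  proof (cases "g t" rule: ennreal_cases)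
    case (real v)
    then have "{s. 0 < s \<and> ennreal s < g t} = {0<..<v}" by (auto simp: ennreal_less_iff)
    then show ?thesis using real by simp
  next
    case top
    then have "{s. 0 < s \<and> ennreal s < g t} = {0<..}" by auto
    moreover have "emeasure lborel {0::real<..} = top"
    proof (cases "emeasure lborel {0::real<..}" rule: ennreal_cases)
      case (real v)
      have "ennreal (v + 1) = emeasure lborel {0<..v + 1}" using real by simp
      also have "\<dots> \<le> emeasure lborel {0::real<..}" by (rule emeasure_mono) auto
      finally show ?thesis using real by simp
    qed
    ultimately show ?thesis using top by simp
  qed
  have "(\<integral>\<^sup>+t. g t \<partial>M) = (\<integral>\<^sup>+t. \<integral>\<^sup>+s. indicator {s. 0 < s \<and> ennreal s < g t} s \<partial>lborel \<partial>M)"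
    using slice by simp
  also have "\<dots> = (\<integral>\<^sup>+s. \<integral>\<^sup>+t. indicator {s. 0 < s \<and> ennreal s < g t} s \<partial>M \<partial>lborel)"
    by (rule Fubini'[symmetric]) (simp add: indicator_def, measurable)
  also have "\<dots> = (\<integral>\<^sup>+s\<in>{0<..}. emeasure M {t \<in> space M. ennreal s < g t} \<partial>lborel)"
  proof (rule nn_integral_cong)
    fix s :: real
    have "(\<integral>\<^sup>+t. indicator {s. 0 < s \<and> ennreal s < g t} s \<partial>M)
        = (\<integral>\<^sup>+t. indicator {0<..} s * indicator {t \<in> space M. ennreal s < g t} t \<partial>M)"
      by (rule nn_integral_cong) (auto simp: indicator_def)
    also have "\<dots> = emeasure M {t \<in> space M. ennreal s < g t} * indicator {0<..} s"
      by (subst nn_integral_cmult_indicator) (measurable, simp add: mult.commute)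
    finally show "(\<integral>\<^sup>+t. indicator {s. 0 < s \<and> ennreal s < g t} s \<partial>M)
        = emeasure M {t \<in> space M. ennreal s < g t} * indicator {0<..} s" .
  qed
  finally show ?thesis .
qed

text \<open>The distribution function of the \<open>r\<close>-th power of
  \<open>\<bar>x\<bar>\<close>. Replacing \<open>s\<close> by \<open>max 0 s\<close> makes it
  antitone on the whole line, as \<open>level_function\<close> demands.\<close>

definition distr_fun :: "real \<Rightarrow> (real \<Rightarrow> real) \<Rightarrow> real \<Rightarrow> real" where
  "distr_fun r x s = measure lebesgue {u \<in> {0..1}. max 0 s powr (1 / r) < \<bar>x u\<bar>}"

text \<open>This is what the rearrangement needs of \<open>x\<close>, and it passes directly to
  concatenations, whose level sets are finite unions of affine images.\<close>

definition measurable_levels :: "(real \<Rightarrow> real) \<Rightarrow> bool" where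
  "measurable_levels x \<longleftrightarrow> (\<forall>\<sigma>\<ge>0. {u \<in> {0..1}. \<sigma> < \<bar>x u\<bar>} \<in> sets lebesgue)"

lemma measurable_levelsI:
  assumes "x \<in> borel_measurable (lebesgue_on {0..1})" shows "measurable_levels x"
  unfolding measurable_levels_def
proof (intro allI impI)
  fix \<sigma> :: real
  have "{u \<in> space (lebesgue_on {0..1}). \<sigma> < \<bar>x u\<bar>} \<in> sets (lebesgue_on {0..1})"
    using assms by measurable
  then show "{u \<in> {0..1}. \<sigma> < \<bar>x u\<bar>} \<in> sets lebesgue"
    by (simp add: sets_restrict_space_iff)
qed

lemma level_set_lmeasurable:
  assumes "measurable_levels x" "\<sigma> \<ge> 0"
  shows "{u \<in> {0..1}. \<sigma> < \<bar>x u\<bar>} \<in> lmeasurable"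
proof (rule bounded_set_imp_lmeasurable)
  show "bounded {u \<in> {0..1}. \<sigma> < \<bar>x u\<bar>}"
    by (rule bounded_subset[of "{0..1}"]) auto
qed (use assms in \<open>auto simp: measurable_levels_def\<close>)

lemma measure_unit_subset:
  assumes "A \<in> lmeasurable" "A \<subseteq> {0..1::real}" shows "measure lebesgue A \<in> {0..1}"
  using measure_mono_fmeasurable[OF assms(2), of lebesgue] assms(1) by (auto simp: fmeasurableD)

lemma level_function_distr_fun:
  assumes "measurable_levels x" "r > 0" shows "level_function (distr_fun r x)"
  unfolding level_function_def
proof
  show "antimono (distr_fun r x)"
  proof (rule antimonoI)
    fix s t :: real assume "s \<le> t"
    then have "max 0 s powr (1 / r) \<le> max 0 t powr (1 / r)" using assms by (intro powr_mono2) auto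
    then show "distr_fun r x t \<le> distr_fun r x s"
      unfolding distr_fun_def using level_set_lmeasurable[OF assms(1)]
      by (intro measure_mono_fmeasurable) (auto simp: fmeasurableD)
  qed
  show "range (distr_fun r x) \<subseteq> {0..1}"
    unfolding distr_fun_def using level_set_lmeasurable[OF assms(1)]
    by (intro image_subsetI measure_unit_subset) auto
qed

text \<open>The point is that the infimum in the rearrangement is attained: the sets where
  \<open>\<bar>x\<bar>\<close> exceeds \<open>\<tau> n\<close> increase to the set where it exceeds
  \<sigma> as \<open>\<tau> n\<close> decreases to \<sigma>, so the distribution function is
  continuous from the right.\<close>

lemma less_decr_rearrangement_iff:
  assumes x: "measurable_levels x"
  shows "\<sigma> < decr_rearrangement x t \<longleftrightarrow>
      ennreal t < emeasure (lebesgue_on {0..1}) {u \<in> {0..1}. \<sigma> < ennreal \<bar>x u\<bar>}"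
proof -
  define D where "D \<sigma> = emeasure (lebesgue_on {0..1}) {u \<in> {0..1}. \<sigma> < ennreal \<bar>x u\<bar>}" for \<sigma>
  have sets: "{u \<in> {0..1}. \<sigma> < ennreal \<bar>x u\<bar>} \<in> sets (lebesgue_on {0..1})" for \<sigma>
  proof (cases \<sigma> rule: ennreal_cases)
    case (real v)
    then have "{u \<in> {0..1}. \<sigma> < ennreal \<bar>x u\<bar>} = {u \<in> {0..1}. v < \<bar>x u\<bar>}"
      by (auto simp: ennreal_less_iff)
    then show ?thesis using x real by (auto simp: sets_restrict_space_iff measurable_levels_def)
  qed simp
  have anti: "D \<tau> \<le> D \<sigma>" if "\<sigma> \<le> \<tau>" for \<sigma> \<tau>
    unfolding D_def using that by (intro emeasure_mono sets) (auto intro: le_less_trans)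
  have "decr_rearrangement x t \<le> \<sigma> \<longleftrightarrow> D \<sigma> \<le> ennreal t"
  proof
    assume "D \<sigma> \<le> ennreal t"
    then show "decr_rearrangement x t \<le> \<sigma>"
      unfolding decr_rearrangement_def D_def by (intro Inf_lower) simp
  next
    assume le: "decr_rearrangement x t \<le> \<sigma>"
    show "D \<sigma> \<le> ennreal t"
    proof (cases \<sigma> rule: ennreal_cases)
      case (real v)
      have Dt: "D \<tau> \<le> ennreal t" if "\<sigma> < \<tau>" for \<tau>
      proof -
        have "decr_rearrangement x t < \<tau>" using le that by simp
        then obtain s where "D s \<le> ennreal t" "s < \<tau>"
          unfolding decr_rearrangement_def Inf_less_iff D_def by auto
        then show ?thesis using anti[of s \<tau>] by (meson less_imp_le order_trans)
      qed
      define \<tau> where "\<tau> n = ennreal (v + 1 / real (Suc n))" for n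
      have \<tau>: "\<sigma> < \<tau> n" for n using real by (simp add: \<tau>_def ennreal_less_iff)
      have "D \<sigma> = emeasure (lebesgue_on {0..1}) (\<Union>n. {u \<in> {0..1}. \<tau> n < ennreal \<bar>x u\<bar>})"
      proof -
        have "\<exists>n. \<tau> n < ennreal \<bar>x u\<bar>" if "\<sigma> < ennreal \<bar>x u\<bar>" for u
        proof -
          have "0 < \<bar>x u\<bar> - v" using that real by (simp add: ennreal_less_iff)
          then obtain n where "1 / real (Suc n) < \<bar>x u\<bar> - v"
            using nat_approx_posE by blast
          then show ?thesis using real by (intro exI[of _ n]) (simp add: \<tau>_def ennreal_less_iff del: ennreal_plus)
        qed
        then have "{u \<in> {0..1}. \<sigma> < ennreal \<bar>x u\<bar>} = (\<Union>n. {u \<in> {0..1}. \<tau> n < ennreal \<bar>x u\<bar>})"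
          using \<tau> by (auto intro: less_trans)
        then show ?thesis by (simp add: D_def)
      qed
      also have "\<dots> = (SUP n. D (\<tau> n))"
        unfolding D_def
      proof (rule SUP_emeasure_incseq[symmetric])
        show "incseq (\<lambda>n. {u \<in> {0..1}. \<tau> n < ennreal \<bar>x u\<bar>})"
        proof (rule incseq_SucI)
          fix n
          have "\<tau> (Suc n) \<le> \<tau> n" unfolding \<tau>_def by (intro ennreal_leI add_left_mono divide_left_mono) auto
          then show "{u \<in> {0..1}. \<tau> n < ennreal \<bar>x u\<bar>} \<subseteq> {u \<in> {0..1}. \<tau> (Suc n) < ennreal \<bar>x u\<bar>}"
            by auto
        qed
      qed (use sets in auto)
      also have "\<dots> \<le> ennreal t" using Dt \<tau> by (intro SUP_least) auto
      finally show ?thesis .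
    qed (simp add: D_def)
  qed
  then show ?thesis by (metis D_def not_le)
qed

lemma unit_bijection_powr:
  assumes "unit_bijection \<phi>" "r > 0" shows "unit_bijection (\<lambda>t. \<phi> t powr r)"
proof -
  interpret unit_bijection \<phi> by fact
  show ?thesis
  proof
    have "strict_mono_on {0..1} (\<lambda>t. \<phi> t powr r)"
    proof (rule strict_mono_onI)
      fix s t :: real assume st: "s \<in> {0..1}" "t \<in> {0..1}" "s < t"
      then have "\<phi> s < \<phi> t" using mono[of t s] by (simp add: not_le[symmetric])
      then show "\<phi> s powr r < \<phi> t powr r" using nonneg[OF st(1)] assms by (intro powr_less_mono2) auto
    qed
    moreover have "(\<lambda>t. \<phi> t powr r) ` {0..1} = {0..1}"
    proof (intro equalityI subsetI)
      fix y assume "y \<in> (\<lambda>t. \<phi> t powr r) ` {0..1}"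
      then obtain t where "t \<in> {0..1}" "y = \<phi> t powr r" by auto
      then show "y \<in> {0..1}" using mem[of t] assms by (auto intro: powr_le1)
    next
      fix y :: real assume y: "y \<in> {0..1}"
      then have y': "y powr (1 / r) \<in> {0..1}" using assms by (auto intro: powr_le1)
      then have "\<phi> (inv_into {0..1} \<phi> (y powr (1 / r))) powr r = y"
        using assms y img by (simp add: f_inv_into_f powr_powr)
      moreover have "inv_into {0..1} \<phi> (y powr (1 / r)) \<in> {0..1}" using y' img by (metis inv_into_into)
      ultimately show "y \<in> (\<lambda>t. \<phi> t powr r) ` {0..1}" by force
    qed
    ultimately show "increasing_bijection {0..1} (\<lambda>t. \<phi> t powr r)"
      by (simp add: increasing_bijection_def bij_betw_def strict_mono_on_imp_inj_on)
  qed
qed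

section \<open>The Stieltjes measure of an increasing bijection\<close>

context unit_bijection
begin

definition clamped :: "real \<Rightarrow> real" where "clamped t = \<Phi> (max 0 (min 1 t))"

lemma clamped_mono: "s \<le> t \<Longrightarrow> clamped s \<le> clamped t"
  unfolding clamped_def by (subst mono) auto

text \<open>Extended by the identity outside the unit interval, \<open>\<Phi>\<close> becomes a
  monotone map of the line onto itself. A monotone map with open range is continuous, and composing
  with the clamp returns \<open>clamped\<close>.\<close>

lemma continuous_clamped: "continuous_on UNIV clamped"
proof -
  define h where "h t = (if t < 0 then t else if t > 1 then t else \<Phi> t)" for t
  have "continuous_on UNIV h"
  proof (rule continuous_onI_mono)
    have "y \<in> range h" for y
    proof (cases "y \<in> {0..1}")
      case True
      then have "y \<in> \<Phi> ` {0..1}" using img by simp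
      then obtain t where "t \<in> {0..1}" "\<Phi> t = y" by auto
      then have "h t = y" by (simp add: h_def)
      then show ?thesis by (rule range_eqI[OF sym])
    next
      case False
      then have "h y = y" by (auto simp: h_def)
      then show ?thesis by (rule range_eqI[OF sym])
    qed
    then have "range h = UNIV" by auto
    then show "open (range h)" by simp
    show "h s \<le> h t" if "s \<le> t" for s t
      using that mono[of s t] mem[of s] mem[of t] by (auto simp: h_def)
  qed
  then have cont: "continuous_on UNIV (\<lambda>t. h (max 0 (min 1 t)))"
    by (rule continuous_on_compose2) (auto intro!: continuous_intros)
  have "(\<lambda>t. h (max 0 (min 1 t))) = clamped"
    by (auto simp: h_def clamped_def)
  from cont[unfolded this] show ?thesis .
qed

text \<open>Half-open intervals are the form in which the level sets of the rearrangement arise; by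
  continuity the right end point carries no mass.\<close>

lemma emeasure_interval_measure_clamped:
  assumes \<delta>: "\<delta> \<in> {0..1}"
  shows "emeasure (interval_measure clamped) {0..<\<delta>} = ennreal (\<Phi> \<delta>)"
proof -
  note Icc = emeasure_interval_measure_Icc[OF _ clamped_mono continuous_clamped]
  have "{0..<\<delta>} = {0..\<delta>} - {\<delta>..\<delta>}" using \<delta> by auto
  also have "emeasure (interval_measure clamped) \<dots>
      = emeasure (interval_measure clamped) {0..\<delta>} - emeasure (interval_measure clamped) {\<delta>..\<delta>}"
    using \<delta> Icc[of \<delta> \<delta>] by (intro emeasure_Diff) auto
  also have "\<dots> = ennreal (\<Phi> \<delta>)"
    using \<delta> Icc[of \<delta> \<delta>] Icc[of 0 \<delta>] by (simp add: clamped_def zero)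
  finally show ?thesis .
qed

end

text \<open>The layer cake formula for the Stieltjes measure: the \<open>r\<close>-th power of the
  rearrangement exceeds \<open>s\<close> exactly on \<open>{0..<distr_fun r x s}\<close>, which has
  mass \<open>\<phi> (distr_fun r x s) powr r\<close>.\<close>

lemma Lorentz_norm_eq:
  assumes \<phi>: "unit_bijection \<phi>" and r: "r \<ge> 1" and x: "measurable_levels x"
  shows "Lorentz_norm \<phi> r x = ennreal_powr (level_integral (\<lambda>t. \<phi> t powr r) (distr_fun r x)) (1 / r)"
proof -
  interpret unit_bijection "\<lambda>t. \<phi> t powr r" using \<phi> r by (intro unit_bijection_powr) auto
  have M: "Lorentz_measure \<phi> r = interval_measure clamped"
    by (simp add: Lorentz_measure_def clamped_def[abs_def])
  \<comment> \<open>The indicator is part of \<open>g\<close> because \<open>ennreal t\<close> is 0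
    for negative \<open>t\<close>, so negative \<open>t\<close> would otherwise enter the level
    sets.\<close>
  define g where "g t = ennreal_powr (decr_rearrangement x t) r * indicator {0..1} t" for t
  have level: "{t. ennreal s < g t} = {0..<distr_fun r x s}" if s: "s \<ge> 0" for s
  proof -
    have lm: "{u \<in> {0..1}. s powr (1 / r) < \<bar>x u\<bar>} \<in> lmeasurable"
      by (rule level_set_lmeasurable[OF x]) simp
    have less: "{u \<in> {0..1}. ennreal (s powr (1 / r)) < ennreal \<bar>x u\<bar>} = {u \<in> {0..1}. s powr (1 / r) < \<bar>x u\<bar>}"
      by (simp add: ennreal_less_iff)
    have "emeasure (lebesgue_on {0..1}) {u \<in> {0..1}. s powr (1 / r) < \<bar>x u\<bar>}
        = emeasure lebesgue {u \<in> {0..1}. s powr (1 / r) < \<bar>x u\<bar>}"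
      by (rule emeasure_restrict_space) auto
    also have "\<dots> = ennreal (distr_fun r x s)"
      unfolding distr_fun_def max_absorb2[OF s] by (rule emeasure_eq_measure2[OF lm])
    finally have D: "emeasure (lebesgue_on {0..1}) {u \<in> {0..1}. ennreal (s powr (1 / r)) < ennreal \<bar>x u\<bar>}
        = ennreal (distr_fun r x s)"
      unfolding less .
    have eq: "ennreal s < ennreal_powr (decr_rearrangement x t) r \<longleftrightarrow> ennreal t < ennreal (distr_fun r x s)" for t
      using r s by (subst ennreal_less_powr_iff) (auto simp only: less_decr_rearrangement_iff[OF x] D)
    have "distr_fun r x s \<le> 1" using level_function_mem[OF level_function_distr_fun[OF x], of r s] r by simp
    then show ?thesis
      by (auto simp: g_def indicator_def eq ennreal_less_iff)
  qed
  have "g \<in> borel_measurable borel"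
  proof (rule borel_measurableI_greater)
    fix y
    show "{t \<in> space borel. y < g t} \<in> sets borel"
      by (cases y rule: ennreal_cases) (auto simp: level)
  qed
  then have "(\<integral>\<^sup>+t. g t \<partial>interval_measure clamped)
      = (\<integral>\<^sup>+s\<in>{0<..}. emeasure (interval_measure clamped) {t \<in> space (interval_measure clamped). ennreal s < g t} \<partial>lborel)"
    by (intro nn_integral_layer_cake sigma_finite_interval_measure)
      (auto simp: clamped_mono continuous_on_imp_continuous_within[OF continuous_clamped])
  also have "\<dots> = level_integral (\<lambda>t. \<phi> t powr r) (distr_fun r x)"
    unfolding level_integral_def
    using level_function_mem[OF level_function_distr_fun[OF x]] r
    by (intro nn_integral_cong) (auto simp: indicator_def level emeasure_interval_measure_clamped)
  finally show ?thesis
    by (simp add: Lorentz_norm_def M g_def)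
qed

section \<open>Distribution functions of concatenations\<close>

lemma level_set_concat_functions:
  assumes n: "n \<ge> 1" and \<sigma>: "\<sigma> \<ge> 0"
  shows "{u \<in> {0..1}. \<sigma> < \<bar>concat_functions n x u\<bar>}
    = (\<Union>k\<in>{1..n}. (\<lambda>v. (1 / real n) *\<^sub>R v + (real k - 1) / real n) ` ({v \<in> {0..1}. \<sigma> < \<bar>x k v\<bar>} - {0, 1}))"
    (is "?L = (\<Union>k\<in>{1..n}. ?T k ` ?S k)")
proof -
  have n0: "real n > 0" using n by simp
  define I where "I k = {(real k - 1) / real n<..<real k / real n}" for k :: nat
  have Ik: "u \<in> I k \<longleftrightarrow> real k - 1 < real n * u \<and> real n * u < real k" for u k
    using n0 by (auto simp: I_def field_simps)
  have uniq: "k = l" if "u \<in> I k" "u \<in> I l" for u k l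
    using that unfolding Ik by linarith
  have val: "concat_functions n x u = \<bar>x k (real n * u - real k + 1)\<bar>" if "k \<in> {1..n}" "u \<in> I k" for u k
  proof -
    have "concat_functions n x u = (\<Sum>l\<in>{k}. indicator (I l) u * \<bar>x l (real n * u - real l + 1)\<bar>)"
      unfolding concat_functions_def I_def[symmetric]
      using that uniq by (intro sum.mono_neutral_right) (auto simp: indicator_def)
    then show ?thesis using that by simp
  qed
  have ex: "\<exists>k\<in>{1..n}. u \<in> I k" if "concat_functions n x u \<noteq> 0" for u
  proof (rule ccontr)
    assume "\<not> (\<exists>k\<in>{1..n}. u \<in> I k)"
    then have "concat_functions n x u = 0"
      unfolding concat_functions_def I_def[symmetric] by (intro sum.neutral) (simp add: indicator_def)
    with that show False by simp
  qed
  \<comment> \<open>The points 0 and 1 are removed from the level sets of \<open>x k\<close> because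
    they are mapped to the division points, at which the concatenation vanishes.\<close>
  have im: "u \<in> ?T k ` ?S k \<longleftrightarrow> u \<in> I k \<and> \<sigma> < \<bar>x k (real n * u - real k + 1)\<bar>" for u k
  proof
    assume "u \<in> ?T k ` ?S k"
    then obtain v where v: "v \<in> ?S k" "u = ?T k v" by blast
    then have "real n * u - real k + 1 = v" using n0 by (simp add: field_simps)
    with v show "u \<in> I k \<and> \<sigma> < \<bar>x k (real n * u - real k + 1)\<bar>" by (auto simp: Ik)
  next
    assume "u \<in> I k \<and> \<sigma> < \<bar>x k (real n * u - real k + 1)\<bar>"
    then show "u \<in> ?T k ` ?S k"
      using n0 by (intro image_eqI[of _ _ "real n * u - real k + 1"]) (auto simp: Ik field_simps)
  qed
  have unit: "u \<in> {0..1}" if "k \<in> {1..n}" "u \<in> I k" for u k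
  proof -
    have "1 \<le> real k" "real k \<le> real n" using that by auto
    then have "0 \<le> real n * u" "real n * u \<le> real n * 1" using that(2) unfolding Ik by linarith+
    then show ?thesis using n0 by (simp add: zero_le_mult_iff)
  qed
  show ?thesis
  proof (intro equalityI subsetI)
    fix u assume u: "u \<in> ?L"
    then have "concat_functions n x u \<noteq> 0" using \<sigma> by auto
    then obtain k where k: "k \<in> {1..n}" "u \<in> I k" using ex by blast
    with u val[OF k] have "u \<in> ?T k ` ?S k" by (simp only: im mem_Collect_eq abs_abs)
    then show "u \<in> (\<Union>k\<in>{1..n}. ?T k ` ?S k)" by (rule UN_I[OF k(1)])
  next
    fix u assume "u \<in> (\<Union>k\<in>{1..n}. ?T k ` ?S k)"
    then obtain k where k: "k \<in> {1..n}" "u \<in> ?T k ` ?S k" by (rule UN_E)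
    then have "u \<in> I k" "\<sigma> < \<bar>x k (real n * u - real k + 1)\<bar>" by (simp_all only: im)
    with val[OF k(1)] unit[OF k(1)] show "u \<in> ?L" by simp
  qed
qed

text \<open>The pieces of the level set lie in disjoint open intervals, and each is an affine image
  with factor \<open>1 / real n\<close> of a level set of \<open>x k\<close> up to two
  points.\<close>

lemma concat_functions_levels:
  assumes n: "n \<ge> 1" and x: "\<And>k. k \<in> {1..n} \<Longrightarrow> measurable_levels (x k)" and \<sigma>: "\<sigma> \<ge> 0"
  shows "{u \<in> {0..1}. \<sigma> < \<bar>concat_functions n x u\<bar>} \<in> sets lebesgue" (is ?m)
    and "measure lebesgue {u \<in> {0..1}. \<sigma> < \<bar>concat_functions n x u\<bar>}
      = mean n (\<lambda>k. measure lebesgue {u \<in> {0..1}. \<sigma> < \<bar>x k u\<bar>})" (is ?e)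
proof -
  have n0: "real n > 0" using n by simp
  define S where "S k = {v \<in> {0..1}. \<sigma> < \<bar>x k v\<bar>} - {0, 1}" for k
  define T where "T k v = (1 / real n) *\<^sub>R v + (real k - 1) / real n" for k :: nat and v :: real
  have S: "S k \<in> lmeasurable" if "k \<in> {1..n}" for k
    unfolding S_def using level_set_lmeasurable[OF x[OF that] \<sigma>]
    by (intro fmeasurable.Diff) (auto intro: bounded_set_imp_lmeasurable)
  have ran: "T k ` S k \<subseteq> {(real k - 1) / real n<..<real k / real n}" for k
  proof (rule image_subsetI)
    fix v assume "v \<in> S k"
    then have v: "0 < v" "v < 1" by (auto simp: S_def less_le)
    have "T k v = (v + (real k - 1)) / real n" by (simp add: T_def add_divide_distrib)
    then show "T k v \<in> {(real k - 1) / real n<..<real k / real n}"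
      using v n0 by (simp add: divide_strict_right_mono)
  qed
  have TS: "T k ` S k \<in> lmeasurable" if "k \<in> {1..n}" for k
  proof (rule bounded_set_imp_lmeasurable)
    have "{(real k - 1) / real n<..<real k / real n} \<subseteq> {(real k - 1) / real n..real k / real n}" by auto
    then show "bounded (T k ` S k)" by (rule bounded_subset[OF bounded_closed_interval subset_trans[OF ran]])
    show "T k ` S k \<in> sets lebesgue"
      unfolding T_def using S[OF that]
      by (intro differentiable_image_in_sets_lebesgue differentiable_on_add differentiable_on_const
          bounded_linear_imp_differentiable_on bounded_linear_scaleR_right) auto
  qed
  have eq: "{u \<in> {0..1}. \<sigma> < \<bar>concat_functions n x u\<bar>} = (\<Union>k\<in>{1..n}. T k ` S k)"
    unfolding level_set_concat_functions[OF n \<sigma>] T_def S_def ..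
  show ?m unfolding eq using TS by (intro sets.finite_UN) auto
  have disj: "disjnt (T k ` S k) (T l ` S l)" if "k \<noteq> l" for k l
  proof -
    have "{(real k - 1) / real n<..<real k / real n} \<inter> {(real l - 1) / real n<..<real l / real n} = {}"
    proof (rule ccontr)
      assume "\<not> ?thesis"
      then obtain u where "u \<in> {(real k - 1) / real n<..<real k / real n}" "u \<in> {(real l - 1) / real n<..<real l / real n}"
        by blast
      then have "real k - 1 < u * real n" "u * real n < real k" "real l - 1 < u * real n" "u * real n < real l"
        using n0 by (simp_all only: greaterThanLessThan_iff pos_divide_less_eq pos_less_divide_eq)
      then show False using that by linarith
    qed
    then show ?thesis using ran[of k] ran[of l] unfolding disjnt_def by blast
  qed
  have "measure lebesgue (\<Union>k\<in>{1..n}. T k ` S k) = (\<Sum>k\<in>{1..n}. measure lebesgue (T k ` S k))"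
    using TS disj by (intro measure_UNION') (auto simp: pairwise_def)
  also have "\<dots> = (\<Sum>k\<in>{1..n}. 1 / real n * measure lebesgue {u \<in> {0..1}. \<sigma> < \<bar>x k u\<bar>})"
  proof (rule sum.cong)
    fix k assume k: "k \<in> {1..n}"
    have "measure lebesgue (T k ` S k) = 1 / real n * measure lebesgue (S k)"
      unfolding T_def using measure_lebesgue_affine[of "1 / real n" "(real k - 1) / real n" "S k"] n0 by simp
    also have "measure lebesgue (S k) = measure lebesgue {u \<in> {0..1}. \<sigma> < \<bar>x k u\<bar>}"
      unfolding S_def using fmeasurableD[OF level_set_lmeasurable[OF x[OF k] \<sigma>]]
      by (intro measure_Diff_null_set) (auto intro: finite_imp_null_set_lborel null_sets_completionI)
    finally show "measure lebesgue (T k ` S k) = 1 / real n * measure lebesgue {u \<in> {0..1}. \<sigma> < \<bar>x k u\<bar>}" .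
  qed simp
  finally show ?e unfolding eq mean_def by (simp add: sum_divide_distrib)
qed

lemma measurable_levels_concat_functions:
  "n \<ge> 1 \<Longrightarrow> (\<And>k. k \<in> {1..n} \<Longrightarrow> measurable_levels (x k)) \<Longrightarrow> measurable_levels (concat_functions n x)"
  using concat_functions_levels(1) by (auto simp: measurable_levels_def)

lemma distr_fun_concat_functions:
  "n \<ge> 1 \<Longrightarrow> (\<And>k. k \<in> {1..n} \<Longrightarrow> measurable_levels (x k)) \<Longrightarrow>
    distr_fun r (concat_functions n x) = (\<lambda>s. mean n (\<lambda>k. distr_fun r (x k) s))"
  unfolding distr_fun_def by (intro ext concat_functions_levels(2)) auto

lemma distr_fun_indicator:
  assumes r: "r > 0" and H: "H > 0" and A: "A \<subseteq> {0..1}"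
  shows "distr_fun r (\<lambda>u. H powr (1 / r) * indicator A u) = (\<lambda>s. measure lebesgue A * indicator {..<H} s)"
proof
  fix s
  have less: "max 0 s powr (1 / r) < H powr (1 / r) \<longleftrightarrow> s < H"
  proof
    assume less: "max 0 s powr (1 / r) < H powr (1 / r)"
    show "s < H"
    proof (rule ccontr)
      assume "\<not> s < H"
      then have "H powr (1 / r) \<le> max 0 s powr (1 / r)" using r H by (intro powr_mono2) auto
      with less show False by (meson not_le)
    qed
  next
    assume "s < H"
    then show "max 0 s powr (1 / r) < H powr (1 / r)" using r H by (intro powr_less_mono2) auto
  qed
  have "{u \<in> {0..1}. max 0 s powr (1 / r) < \<bar>H powr (1 / r) * indicator A u\<bar>} = (if s < H then A else {})"
    using A H less by (auto simp: indicator_def not_less)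
  then show "distr_fun r (\<lambda>u. H powr (1 / r) * indicator A u) s = measure lebesgue A * indicator {..<H} s"
    by (simp add: distr_fun_def)
qed

lemma (in unit_bijection) level_integral_step:
  assumes "t \<in> {0..1}" "H > 0"
  shows "level_integral \<Phi> (\<lambda>s. t * indicator {..<H} s) = ennreal (H * \<Phi> t)"
proof -
  have "level_integral \<Phi> (\<lambda>s. t * indicator {..<H} s) = (\<integral>\<^sup>+s. ennreal (\<Phi> t) * indicator {0<..<H} s \<partial>lborel)"
    unfolding level_integral_def using zero by (intro nn_integral_cong) (auto simp: indicator_def)
  also have "\<dots> = ennreal (H * \<Phi> t)"
    using assms nonneg[OF assms(1)] by (simp add: nn_integral_cmult_indicator ennreal_mult mult.commute)
  finally show ?thesis .
qed

lemma indicator_in_Lorentz_space: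
  assumes \<phi>: "unit_bijection \<phi>" and r: "r \<ge> 1" and H: "H > 0" and A: "A \<subseteq> {0..1}" "A \<in> lmeasurable"
  defines "f \<equiv> \<lambda>u. H powr (1 / r) * indicator A u"
  shows "f \<in> Lorentz_space \<phi> r" (is ?m)
    and "Lorentz_norm \<phi> r f = ennreal ((H * \<phi> (measure lebesgue A) powr r) powr (1 / r))" (is ?n)
proof -
  interpret \<Phi>: unit_bijection "\<lambda>t. \<phi> t powr r" using \<phi> r by (intro unit_bijection_powr) auto
  have "A \<in> sets (lebesgue_on {0..1})" using A by (auto simp: sets_restrict_space_iff)
  then have f: "f \<in> borel_measurable (lebesgue_on {0..1})"
    unfolding f_def by (intro borel_measurable_times borel_measurable_const borel_measurable_indicator)
  have "measure lebesgue A \<in> {0..1}" using A by (intro measure_unit_subset)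
  then have "level_integral (\<lambda>t. \<phi> t powr r) (distr_fun r f) = ennreal (H * \<phi> (measure lebesgue A) powr r)"
    unfolding f_def using H r A(1) by (subst distr_fun_indicator) (auto intro!: \<Phi>.level_integral_step)
  then show ?n
    using Lorentz_norm_eq[OF \<phi> r measurable_levelsI[OF f]] H by (simp add: ennreal_powr_ennreal)
  then show ?m using f by (simp add: Lorentz_space_def)
qed

text \<open>The norm of the indicator function of a set of measure \<open>t\<close> is
  \<open>\<phi> t\<close>. The triangle inequality of the equivalent norm, applied to the two halves
  of \<open>{0..t}\<close>, therefore compares \<open>\<phi> t\<close> with
  \<open>\<phi> (t / 2)\<close>.\<close>

lemma equivalent_to_norm_imp_doubling:
  assumes \<phi>: "unit_bijection \<phi>" and r: "r \<ge> 1"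
    and eq: "equivalent_to_norm (Lorentz_space \<phi> r) (Lorentz_norm \<phi> r)"
  obtains D where "D \<ge> 1" "\<forall>t\<in>{0..1}. \<phi> t powr r \<le> D * \<phi> (t / 2) powr r"
proof -
  interpret unit_bijection \<phi> by fact
  obtain P c C where P: "function_norm (Lorentz_space \<phi> r) P" and c: "c > 0" "C > 0"
    and le: "\<And>x. x \<in> Lorentz_space \<phi> r \<Longrightarrow> ennreal c * Lorentz_norm \<phi> r x \<le> ennreal (P x)"
    and ge: "\<And>x. x \<in> Lorentz_space \<phi> r \<Longrightarrow> ennreal (P x) \<le> ennreal C * Lorentz_norm \<phi> r x"
    using eq unfolding equivalent_to_norm_def by blast
  have add: "P (\<lambda>t. x t + y t) \<le> P x + P y" if "x \<in> Lorentz_space \<phi> r" "y \<in> Lorentz_space \<phi> r" for x y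
    using P that unfolding function_norm_def by blast
  have nn: "P x \<ge> 0" if "x \<in> Lorentz_space \<phi> r" for x
    using P that unfolding function_norm_def by blast
  have ind: "indicator A \<in> Lorentz_space \<phi> r" "c * \<phi> (measure lebesgue A) \<le> P (indicator A)"
    "P (indicator A) \<le> C * \<phi> (measure lebesgue A)"
    if A: "A \<subseteq> {0..1}" "A \<in> lmeasurable" for A
  proof -
    have m: "\<phi> (measure lebesgue A) \<ge> 0" using A by (intro nonneg measure_unit_subset)
    show E: "indicator A \<in> Lorentz_space \<phi> r"
      using indicator_in_Lorentz_space(1)[OF \<phi> r zero_less_one A] by simp
    have N: "Lorentz_norm \<phi> r (indicator A) = ennreal (\<phi> (measure lebesgue A))"
      using indicator_in_Lorentz_space(2)[OF \<phi> r zero_less_one A] r m by (simp add: powr_powr)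
    show "c * \<phi> (measure lebesgue A) \<le> P (indicator A)"
      using le[OF E] c m nn[OF E] unfolding N by (simp add: ennreal_mult[symmetric])
    show "P (indicator A) \<le> C * \<phi> (measure lebesgue A)"
      using ge[OF E] c m unfolding N by (simp add: ennreal_mult[symmetric])
  qed
  define K where "K = max 1 (2 * C / c)"
  have K: "\<phi> t \<le> K * \<phi> (t / 2)" if t: "t \<in> {0..1}" for t
  proof -
    define A where "A = {0..t / 2}"
    define B where "B = {t / 2<..t}"
    have AB: "A \<subseteq> {0..1}" "A \<in> lmeasurable" "B \<subseteq> {0..1}" "B \<in> lmeasurable"
      "measure lebesgue A = t / 2" "measure lebesgue B = t / 2"
      using t bounded_subset[OF bounded_closed_interval[of 0 t], of "{t / 2<..t}"]
      by (auto simp: A_def B_def intro!: bounded_set_imp_lmeasurable)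
    have "c * \<phi> (measure lebesgue {0..t}) \<le> P (indicator {0..t})"
      using t by (intro ind) auto
    also have "indicator {0..t} = (\<lambda>u. indicator A u + indicator B u :: real)"
      using t by (auto simp: A_def B_def indicator_def)
    also have "P (\<lambda>u. indicator A u + indicator B u) \<le> P (indicator A) + P (indicator B)"
      using AB by (intro add ind)
    also have "\<dots> \<le> C * \<phi> (t / 2) + C * \<phi> (t / 2)"
      using ind(3)[OF AB(1,2)] ind(3)[OF AB(3,4)] unfolding AB(5,6) by linarith
    finally have "\<phi> t \<le> 2 * C / c * \<phi> (t / 2)"
      using c t by (simp add: field_simps)
    also have "\<dots> \<le> K * \<phi> (t / 2)"
      using t by (intro mult_right_mono nonneg) (auto simp: K_def)
    finally show ?thesis .
  qed
  show thesis
  proof (rule that[of "K powr r"])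
    show "K powr r \<ge> 1" using r by (intro ge_one_powr_ge_zero) (auto simp: K_def)
    show "\<forall>t\<in>{0..1}. \<phi> t powr r \<le> K powr r * \<phi> (t / 2) powr r"
    proof
      fix t :: real assume t: "t \<in> {0..1}"
      have "\<phi> t powr r \<le> (K * \<phi> (t / 2)) powr r"
        using K[OF t] nonneg[OF t] r by (intro powr_mono2) auto
      also have "\<dots> = K powr r * \<phi> (t / 2) powr r" by (rule powr_mult)
      finally show "\<phi> t powr r \<le> K powr r * \<phi> (t / 2) powr r" .
    qed
  qed
qed

section \<open>The two equivalences\<close>

text \<open>\<open>a powi k\<close> is at least 1 exactly for \<open>k \<ge> 0\<close>, so the
  exceptional integers are the images of exceptional natural numbers, and \<open>finite\<close> and
  \<open>card\<close> carry over along the injection \<open>int\<close>. The sequence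
  \<open>p\<close> has the base as a parameter because the grid of powers depends on it.\<close>

lemma almost_convex_iff_seq:
  assumes M: "\<And>a k. a > 1 \<Longrightarrow> M (a ^ k) = 1 / p a k" and p: "\<And>a k. a > 1 \<Longrightarrow> p a k > 0"
  shows "almost_convex M \<longleftrightarrow> (\<exists>a>1. almost_convex_seq a (p a))"
proof -
  have S: "{k::int. a powi k \<in> {1..} \<and> a powi (k + int m) \<in> {1..} \<and>
      \<not> (M (a powi (k + int m)) \<ge> a powi (int m - int N) * M (a powi k))} = int ` bad (p a) a N m"
    (is "?S = _") if a: "a > 1" for a :: real and N m
  proof -
    have ge1: "a powi k \<in> {1..} \<longleftrightarrow> k \<ge> 0" for k
    proof (cases "k \<ge> 0")
      case True
      then show ?thesis using a by (simp add: power_int_def)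
    next
      case False
      have "(1 / a) ^ nat (- k) < (1 / a) ^ 0"
        using a False by (intro power_strict_decreasing) auto
      with False show ?thesis by (simp add: power_int_def inverse_eq_divide)
    qed
    have nat: "int k \<in> ?S \<longleftrightarrow> k \<in> bad (p a) a N m" for k
    proof -
      have e: "a powi (int k + int m) = a ^ (k + m)" "a powi int k = a ^ k"
        "a powi (int m - int N) = a ^ m / a ^ N"
        using a by (simp_all add: power_int_diff flip: of_nat_add)
      have "\<not> (M (a ^ (k + m)) \<ge> a ^ m / a ^ N * M (a ^ k)) \<longleftrightarrow> k \<in> bad (p a) a N m"
        using a p[OF a, of k] p[OF a, of "k + m"] unfolding M[OF a] bad_def not_le
        by (simp add: field_simps)
      moreover have "a powi int k \<in> {1..}" "a powi (int k + int m) \<in> {1..}" using a by (auto simp: one_le_power simp flip: of_nat_add)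
      ultimately show ?thesis unfolding mem_Collect_eq e by simp
    qed
    show ?thesis
    proof (intro equalityI subsetI)
      fix k assume k: "k \<in> ?S"
      then have "k \<ge> 0" by (simp add: ge1[unfolded atLeast_iff])
      then obtain k' where "k = int k'" using nonneg_int_cases by blast
      with k nat show "k \<in> int ` bad (p a) a N m" by blast
    qed (use nat in blast)
  qed
  have inj: "inj_on int X" for X by (simp add: inj_on_def)
  have "(\<exists>b>1. \<exists>N\<ge>1. \<forall>m::nat. m \<ge> 1 \<longrightarrow>
      (let S = {k::int. a powi k \<in> {1..} \<and> a powi (k + int m) \<in> {1..} \<and>
          \<not> (M (a powi (k + int m)) \<ge> a powi (int m - int N) * M (a powi k))}
       in finite S \<and> real (card S) < b ^ m)) \<longleftrightarrow> almost_convex_seq a (p a)" if "a > 1" for a :: real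
    unfolding Let_def S[OF that] finite_image_iff[OF inj] card_image[OF inj] almost_convex_seq_def ..
  then show ?thesis unfolding almost_convex_def by blast
qed

lemma almost_convex_phi_tilde_iff:
  assumes \<phi>: "unit_bijection \<phi>" and r: "r \<ge> 1"
  shows "almost_convex (\<lambda>t. phi_tilde \<phi> t powr r) \<longleftrightarrow>
      (\<exists>a>1. almost_convex_seq a (\<lambda>k. \<phi> ((1 / a) ^ k) powr r))"
proof (rule almost_convex_iff_seq)
  interpret \<Phi>: unit_bijection "\<lambda>t. \<phi> t powr r" using \<phi> r by (intro unit_bijection_powr) auto
  interpret unit_bijection \<phi> by fact
  fix a :: real and k assume a: "a > 1"
  then have "\<phi> ((1 / a) ^ k) > 0" by (rule pos_seq)
  then show "phi_tilde \<phi> (a ^ k) powr r = 1 / \<phi> ((1 / a) ^ k) powr r"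
    by (simp add: phi_tilde_def powr_divide power_one_over)
  show "\<phi> ((1 / a) ^ k) powr r > 0" using a by (rule \<Phi>.pos_seq)
qed

text \<open>Taking reciprocals in both variables turns the inverse of
  \<open>phi_tilde \<phi>\<close> at \<open>t powr (1 / r)\<close> into the reciprocal of the
  inverse of the \<open>r\<close>-th power of \<open>\<phi>\<close> at \<open>1 / t\<close>.\<close>

lemma almost_convex_phi_tilde_inverse_iff:
  assumes \<phi>: "unit_bijection \<phi>" and r: "r \<ge> 1"
  shows "almost_convex (\<lambda>t. inv_into {1..} (phi_tilde \<phi>) (t powr (1 / r))) \<longleftrightarrow>
      (\<exists>a>1. almost_convex_seq a (\<lambda>k. inv_into {0..1} (\<lambda>t. \<phi> t powr r) ((1 / a) ^ k)))"
proof (rule almost_convex_iff_seq)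
  interpret \<Phi>: unit_bijection "\<lambda>t. \<phi> t powr r" using \<phi> r by (intro unit_bijection_powr) auto
  interpret inv: unit_bijection \<Phi>.\<Psi> by (rule \<Phi>.unit_bijection_inverse)
  interpret unit_bijection \<phi> by fact
  fix a :: real and k assume a: "a > 1"
  define z where "z = (1 / a) ^ k"
  have z: "z \<in> {0..1}" "z > 0" using a by (auto simp: z_def power_le_one)
  show pos: "\<Phi>.\<Psi> ((1 / a) ^ k) > 0" using a by (rule inv.pos_seq)
  have y: "\<Phi>.\<Psi> z \<in> {0..1}" using z(1) by (rule inv.mem)
  have "(\<phi> (\<Phi>.\<Psi> z) powr r) powr (1 / r) = z powr (1 / r)"
    using \<Phi>.inverse_right[OF z(1)] by (rule arg_cong)
  then have "\<phi> (\<Phi>.\<Psi> z) = z powr (1 / r)" using r nonneg[OF y] by (simp add: powr_powr)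
  then have val: "phi_tilde \<phi> (1 / \<Phi>.\<Psi> z) = (a ^ k) powr (1 / r)"
    using a by (simp add: phi_tilde_def z_def powr_divide power_one_over)
  have inj: "inj_on (phi_tilde \<phi>) {1..}"
    using increasing_bijection_phi_tilde[OF bij] by (simp add: increasing_bijection_def bij_betw_def)
  have "1 / \<Phi>.\<Psi> z \<in> {1..}" using y pos by (simp add: z_def)
  then show "inv_into {1..} (phi_tilde \<phi>) ((a ^ k) powr (1 / r)) = 1 / \<Phi>.\<Psi> ((1 / a) ^ k)"
    unfolding z_def[symmetric] using inj val by (intro inv_into_f_eq)
qed

text \<open>Reduces an estimate by a supremum \<open>S\<close>, possibly 0 or infinite, to the
  positive real bounds of \<open>S\<close>, the form in which \<open>level_integral_mean_le\<close>
  applies.\<close>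

lemma ennreal_le_cmult_if_le_all:
  assumes N: "\<And>w. w > 0 \<Longrightarrow> S \<le> ennreal w \<Longrightarrow> v \<le> ennreal (c * w)" and c: "c > 0"
  shows "v \<le> ennreal c * S"
proof (cases S rule: ennreal_cases)
  case (real s)
  show ?thesis
  proof (rule ennreal_le_epsilon)
    fix e :: real assume e: "e > 0"
    have "v \<le> ennreal (c * (s + e / c))" using real e c by (intro N) (auto simp: add_nonneg_pos)
    also have "\<dots> = ennreal c * S + ennreal e"
      using real e c by (simp add: distrib_left ennreal_mult)
    finally show "v \<le> ennreal c * S + ennreal e" .
  qed
next
  case top
  then show ?thesis using c by (simp add: ennreal_mult_top)
qed

lemma Lorentz_norm_concat_functions:
  assumes \<phi>: "unit_bijection \<phi>" and r: "r \<ge> 1" and n: "n \<ge> 1"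
    and x: "\<And>k. k \<in> {1..n} \<Longrightarrow> measurable_levels (x k)"
  shows "Lorentz_norm \<phi> r (concat_functions n x) =
    ennreal_powr (level_integral (\<lambda>t. \<phi> t powr r) (\<lambda>s. mean n (\<lambda>k. distr_fun r (x k) s))) (1 / r)"
proof -
  have "measurable_levels (concat_functions n x)" using n x by (rule measurable_levels_concat_functions)
  moreover have "distr_fun r (concat_functions n x) = (\<lambda>s. mean n (\<lambda>k. distr_fun r (x k) s))"
    using n x by (rule distr_fun_concat_functions)
  ultimately show ?thesis using Lorentz_norm_eq[OF \<phi> r] by simp
qed

text \<open>Realises the test functions of the two necessity lemmas in the space: the condition on
  \<open>H j\<close> and \<open>t j\<close> is the normalization to norm 1, and the level function
  of \<open>f j\<close> takes the value \<open>t j\<close> on \<open>{..<H j}\<close> and 0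
  beyond.\<close>

lemma step_concat_functions:
  assumes \<phi>: "unit_bijection \<phi>" and r: "r \<ge> 1" and n: "n \<ge> 1"
    and t: "\<And>j. j \<in> {1..n} \<Longrightarrow> 0 < t j \<and> t j \<le> 1 \<and> 0 < H j \<and> H j * \<phi> (t j) powr r = 1"
  defines "f \<equiv> \<lambda>j u. H j powr (1 / r) * indicator {0..t j} u"
  shows "\<And>j. j \<in> {1..n} \<Longrightarrow> f j \<in> Lorentz_space \<phi> r" (is "PROP ?m")
    and "\<And>j. j \<in> {1..n} \<Longrightarrow> Lorentz_norm \<phi> r (f j) = 1" (is "PROP ?n")
    and "Lorentz_norm \<phi> r (concat_functions n f) =
      ennreal_powr (level_integral (\<lambda>t. \<phi> t powr r) (\<lambda>s. mean n (\<lambda>j. t j * indicator {..<H j} s))) (1 / r)" (is ?c)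
proof -
  have A: "{0..t j} \<subseteq> {0..1}" "{0..t j} \<in> lmeasurable" if "j \<in> {1..n}" for j
    using t[OF that] by auto
  have H: "H j > 0" if "j \<in> {1..n}" for j using t[OF that] by simp
  show m: "f j \<in> Lorentz_space \<phi> r" if "j \<in> {1..n}" for j
    unfolding f_def by (rule indicator_in_Lorentz_space(1)[OF \<phi> r H[OF that] A[OF that]])
  show "Lorentz_norm \<phi> r (f j) = 1" if "j \<in> {1..n}" for j
    unfolding f_def indicator_in_Lorentz_space(2)[OF \<phi> r H[OF that] A[OF that]] using t[OF that] by simp
  have lev: "measurable_levels (f j)" if "j \<in> {1..n}" for j
    using m[OF that] by (intro measurable_levelsI) (simp add: Lorentz_space_def)
  have "distr_fun r (f j) = (\<lambda>s. t j * indicator {..<H j} s)" if "j \<in> {1..n}" for j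
    unfolding f_def using t[OF that] r A(1)[OF that] by (subst distr_fun_indicator) auto
  then have "(\<lambda>s. mean n (\<lambda>j. distr_fun r (f j) s)) = (\<lambda>s. mean n (\<lambda>j. t j * indicator {..<H j} s))"
    by (simp add: mean_def)
  then show ?c
    using Lorentz_norm_concat_functions[where x = f, OF \<phi> r n lev] by simp
qed

text \<open>Level integrals are \<open>r\<close>-th powers of norms, so constants pass between the
  two sides as \<open>c powr r\<close> and \<open>c powr (1 / r)\<close>. Necessity always yields
  the base 2, whereas sufficiency starts from an arbitrary base.\<close>

lemma D_convex_iff:
  assumes \<phi>: "unit_bijection \<phi>" and r: "r \<ge> 1"
    and doubling: "D \<ge> 1" "\<forall>t\<in>{0..1}. \<phi> t powr r \<le> D * \<phi> (t / 2) powr r"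
  shows "D_convex (Lorentz_space \<phi> r) (Lorentz_norm \<phi> r) \<longleftrightarrow>
      (\<exists>a>1. almost_convex_seq a (\<lambda>k. \<phi> ((1 / a) ^ k) powr r))"
proof
  interpret \<Phi>: unit_bijection "\<lambda>t. \<phi> t powr r" using \<phi> r by (intro unit_bijection_powr) auto
  assume "D_convex (Lorentz_space \<phi> r) (Lorentz_norm \<phi> r)"
  then obtain c where c: "c > 0" and
    conv: "\<And>n x. n \<ge> 1 \<Longrightarrow> (\<And>k. k \<in> {1..n} \<Longrightarrow> x k \<in> Lorentz_space \<phi> r) \<Longrightarrow>
      Lorentz_norm \<phi> r (concat_functions n x) \<le> ennreal c * (SUP k\<in>{1..n}. Lorentz_norm \<phi> r (x k))"
    unfolding D_convex_def by blast
  have "almost_convex_seq 2 (\<lambda>k. \<phi> ((1 / 2) ^ k) powr r)"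
  proof (rule \<Phi>.almost_convex_if_mean_le[of "c powr r"])
    fix n :: nat and H t :: "nat \<Rightarrow> real"
    assume n: "n \<ge> 1" and t: "\<And>j. j \<in> {1..n} \<Longrightarrow> 0 < t j \<and> t j \<le> 1 \<and> 0 < H j \<and> H j * \<phi> (t j) powr r = 1"
    define f :: "nat \<Rightarrow> real \<Rightarrow> real" where "f = (\<lambda>j u. H j powr (1 / r) * indicator {0..t j} u)"
    have f1: "f j \<in> Lorentz_space \<phi> r" if "j \<in> {1..n}" for j
      unfolding f_def by (rule step_concat_functions(1)[OF \<phi> r n t that])
    have f2: "Lorentz_norm \<phi> r (f j) = 1" if "j \<in> {1..n}" for j
      unfolding f_def by (rule step_concat_functions(2)[OF \<phi> r n t that])
    have f3: "ennreal_powr (level_integral (\<lambda>t. \<phi> t powr r) (\<lambda>s. mean n (\<lambda>j. t j * indicator {..<H j} s))) (1 / r)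
        = Lorentz_norm \<phi> r (concat_functions n f)"
      unfolding f_def by (rule step_concat_functions(3)[OF \<phi> r n t, symmetric])
    have "ennreal_powr (level_integral (\<lambda>t. \<phi> t powr r) (\<lambda>s. mean n (\<lambda>j. t j * indicator {..<H j} s))) (1 / r)
        \<le> ennreal c * (SUP k\<in>{1..n}. Lorentz_norm \<phi> r (f k))"
      unfolding f3 by (rule conv[OF n f1])
    also have "(SUP k\<in>{1..n}. Lorentz_norm \<phi> r (f k)) = (SUP k\<in>{1..n}. 1)"
      by (rule SUP_cong[OF refl f2])
    also have "ennreal c * (SUP k\<in>{1..n}. 1) = ennreal c" using n by simp
    finally show "level_integral (\<lambda>t. \<phi> t powr r) (\<lambda>s. mean n (\<lambda>j. t j * indicator {..<H j} s)) \<le> ennreal (c powr r)"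
      using r c by (simp add: ennreal_powr_le_iff)
  qed
  then show "\<exists>a>1. almost_convex_seq a (\<lambda>k. \<phi> ((1 / a) ^ k) powr r)" by (intro exI[of _ 2]) simp
next
  interpret \<Phi>: unit_bijection "\<lambda>t. \<phi> t powr r" using \<phi> r by (intro unit_bijection_powr) auto
  assume "\<exists>a>1. almost_convex_seq a (\<lambda>k. \<phi> ((1 / a) ^ k) powr r)"
  then obtain a where a: "a > 1" "almost_convex_seq a (\<lambda>k. \<phi> ((1 / a) ^ k) powr r)" by blast
  obtain c where c: "c > 0" and
    main: "\<forall>n\<ge>1. \<forall>R>0. \<forall>d. (\<forall>j\<in>{1..n}. level_function (d j) \<and>
        level_integral (\<lambda>t. \<phi> t powr r) (d j) \<le> ennreal R) \<longrightarrow>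
      level_integral (\<lambda>t. \<phi> t powr r) (\<lambda>s. mean n (\<lambda>j. d j s)) \<le> ennreal (c * R)"
    using \<Phi>.level_integral_mean_le[OF a doubling] by (elim exE conjE) (rule that)
  show "D_convex (Lorentz_space \<phi> r) (Lorentz_norm \<phi> r)"
    unfolding D_convex_def
  proof (intro exI[of _ "c powr (1 / r)"] conjI allI impI)
    show c': "c powr (1 / r) > 0" using c by simp
    fix n :: nat and x :: "nat \<Rightarrow> real \<Rightarrow> real"
    assume n: "1 \<le> n" and x: "\<forall>k\<in>{1..n}. x k \<in> Lorentz_space \<phi> r"
    have lev: "measurable_levels (x k)" if "k \<in> {1..n}" for k
      using x that by (intro measurable_levelsI) (simp add: Lorentz_space_def)
    have N: "Lorentz_norm \<phi> r (concat_functions n x) =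
        ennreal_powr (level_integral (\<lambda>t. \<phi> t powr r) (\<lambda>s. mean n (\<lambda>k. distr_fun r (x k) s))) (1 / r)"
      by (rule Lorentz_norm_concat_functions[OF \<phi> r n lev])
    show "Lorentz_norm \<phi> r (concat_functions n x) \<le> ennreal (c powr (1 / r)) * (SUP k\<in>{1..n}. Lorentz_norm \<phi> r (x k))"
    proof (rule ennreal_le_cmult_if_le_all[OF _ c'])
      fix w :: real assume w: "w > 0" and sup: "(SUP k\<in>{1..n}. Lorentz_norm \<phi> r (x k)) \<le> ennreal w"
      have "level_integral (\<lambda>t. \<phi> t powr r) (distr_fun r (x k)) \<le> ennreal (w powr r)" if k: "k \<in> {1..n}" for k
      proof -
        have "Lorentz_norm \<phi> r (x k) \<le> ennreal w" using sup k by (auto simp: SUP_le_iff)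
        then show ?thesis
          unfolding Lorentz_norm_eq[OF \<phi> r lev[OF k]] using r w by (simp add: ennreal_powr_le_iff)
      qed
      then have "level_integral (\<lambda>t. \<phi> t powr r) (\<lambda>s. mean n (\<lambda>k. distr_fun r (x k) s)) \<le> ennreal (c * w powr r)"
        using w r lev by (intro main[rule_format] n conjI level_function_distr_fun) auto
      moreover have "(c powr (1 / r) * w) powr r = c * w powr r"
        using c w r by (simp add: powr_mult powr_powr)
      ultimately show "Lorentz_norm \<phi> r (concat_functions n x) \<le> ennreal (c powr (1 / r) * w)"
        unfolding N
        using c w r by (subst ennreal_powr_le_iff) auto
    qed
  qed
qed

lemma D_star_convex_iff:
  assumes \<phi>: "unit_bijection \<phi>" and r: "r \<ge> 1"
  shows "D_star_convex (Lorentz_space \<phi> r) (Lorentz_norm \<phi> r) \<longleftrightarrow>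
      (\<exists>a>1. almost_convex_seq a (\<lambda>k. inv_into {0..1} (\<lambda>t. \<phi> t powr r) ((1 / a) ^ k)))"
proof
  interpret \<Phi>: unit_bijection "\<lambda>t. \<phi> t powr r" using \<phi> r by (intro unit_bijection_powr) auto
  assume "D_star_convex (Lorentz_space \<phi> r) (Lorentz_norm \<phi> r)"
  then obtain c where c: "c > 0" and
    conv: "\<And>n x. n \<ge> 1 \<Longrightarrow> (\<And>k. k \<in> {1..n} \<Longrightarrow> x k \<in> Lorentz_space \<phi> r) \<Longrightarrow>
      ennreal (inverse c) * (INF k\<in>{1..n}. Lorentz_norm \<phi> r (x k)) \<le> Lorentz_norm \<phi> r (concat_functions n x)"
    unfolding D_star_convex_def by blast
  have "almost_convex_seq 2 (\<lambda>k. \<Phi>.\<Psi> ((1 / 2) ^ k))"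
  proof (rule \<Phi>.almost_convex_inverse_if_mean_ge[of "inverse c powr r"])
    fix n :: nat and H t :: "nat \<Rightarrow> real"
    assume n: "n \<ge> 1" and t: "\<And>j. j \<in> {1..n} \<Longrightarrow> 0 < t j \<and> t j \<le> 1 \<and> 0 < H j \<and> H j * \<phi> (t j) powr r = 1"
    define f :: "nat \<Rightarrow> real \<Rightarrow> real" where "f = (\<lambda>j u. H j powr (1 / r) * indicator {0..t j} u)"
    have f1: "f j \<in> Lorentz_space \<phi> r" if "j \<in> {1..n}" for j
      unfolding f_def by (rule step_concat_functions(1)[OF \<phi> r n t that])
    have f2: "Lorentz_norm \<phi> r (f j) = 1" if "j \<in> {1..n}" for j
      unfolding f_def by (rule step_concat_functions(2)[OF \<phi> r n t that])
    have f3: "ennreal_powr (level_integral (\<lambda>t. \<phi> t powr r) (\<lambda>s. mean n (\<lambda>j. t j * indicator {..<H j} s))) (1 / r)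
        = Lorentz_norm \<phi> r (concat_functions n f)"
      unfolding f_def by (rule step_concat_functions(3)[OF \<phi> r n t, symmetric])
    have "ennreal (inverse c) = ennreal (inverse c) * (INF k\<in>{1..n}. 1)" using n by simp
    also have "(INF k\<in>{1..n}. 1) = (INF k\<in>{1..n}. Lorentz_norm \<phi> r (f k))"
      by (rule INF_cong[OF refl f2[symmetric]])
    also have "ennreal (inverse c) * \<dots>
      \<le> ennreal_powr (level_integral (\<lambda>t. \<phi> t powr r) (\<lambda>s. mean n (\<lambda>j. t j * indicator {..<H j} s))) (1 / r)"
      unfolding f3 by (rule conv[OF n f1])
    finally show "ennreal (inverse c powr r) \<le> level_integral (\<lambda>t. \<phi> t powr r) (\<lambda>s. mean n (\<lambda>j. t j * indicator {..<H j} s))"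
      using r c by (simp add: ennreal_le_powr_iff)
  qed (use c in simp)
  then show "\<exists>a>1. almost_convex_seq a (\<lambda>k. \<Phi>.\<Psi> ((1 / a) ^ k))" by (intro exI[of _ 2]) simp
next
  interpret \<Phi>: unit_bijection "\<lambda>t. \<phi> t powr r" using \<phi> r by (intro unit_bijection_powr) auto
  assume "\<exists>a>1. almost_convex_seq a (\<lambda>k. \<Phi>.\<Psi> ((1 / a) ^ k))"
  then obtain a where a: "a > 1" "almost_convex_seq a (\<lambda>k. \<Phi>.\<Psi> ((1 / a) ^ k))" by blast
  obtain c where c: "c > 0" and
    main: "\<forall>n\<ge>1. \<forall>R>0. \<forall>d. (\<forall>j\<in>{1..n}. level_function (d j) \<and>
        ennreal R \<le> level_integral (\<lambda>t. \<phi> t powr r) (d j)) \<longrightarrow>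
      ennreal R \<le> ennreal c * level_integral (\<lambda>t. \<phi> t powr r) (\<lambda>s. mean n (\<lambda>j. d j s))"
    using \<Phi>.level_integral_mean_ge[OF a] by (elim exE conjE) (rule that)
  show "D_star_convex (Lorentz_space \<phi> r) (Lorentz_norm \<phi> r)"
    unfolding D_star_convex_def
  proof (intro exI[of _ "c powr (1 / r)"] conjI allI impI)
    show c': "c powr (1 / r) > 0" using c by simp
    fix n :: nat and x :: "nat \<Rightarrow> real \<Rightarrow> real"
    assume n: "1 \<le> n" and x: "\<forall>k\<in>{1..n}. x k \<in> Lorentz_space \<phi> r"
    have lev: "measurable_levels (x k)" if "k \<in> {1..n}" for k
      using x that by (intro measurable_levelsI) (simp add: Lorentz_space_def)
    have N: "Lorentz_norm \<phi> r (concat_functions n x) =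
        ennreal_powr (level_integral (\<lambda>t. \<phi> t powr r) (\<lambda>s. mean n (\<lambda>k. distr_fun r (x k) s))) (1 / r)"
      by (rule Lorentz_norm_concat_functions[OF \<phi> r n lev])
    define I where "I = (INF k\<in>{1..n}. Lorentz_norm \<phi> r (x k))"
    have I_le: "I \<le> Lorentz_norm \<phi> r (x k)" if "k \<in> {1..n}" for k
      unfolding I_def using that by (rule INF_lower)
    \<comment> \<open>The infimum is finite because \<open>x 1\<close> lies in the space. Its value
      0 is treated apart, as \<open>main\<close> is stated for \<open>R > 0\<close>.\<close>
    have "I < \<infinity>" using I_le[of 1] x n by (auto simp: Lorentz_space_def intro: le_less_trans)
    then obtain w where w: "w \<ge> 0" "I = ennreal w" by (cases I rule: ennreal_cases) auto
    show "ennreal (inverse (c powr (1 / r))) * (INF k\<in>{1..n}. Lorentz_norm \<phi> r (x k)) \<le> Lorentz_norm \<phi> r (concat_functions n x)"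
    proof (cases "w = 0")
      case True
      then show ?thesis using w by (simp add: I_def)
    next
      case False
      with w have w0: "w > 0" by simp
      have "ennreal (w powr r) \<le> level_integral (\<lambda>t. \<phi> t powr r) (distr_fun r (x k))" if k: "k \<in> {1..n}" for k
        using I_le[OF k] unfolding w Lorentz_norm_eq[OF \<phi> r lev[OF k]] using r w0 by (simp add: ennreal_le_powr_iff)
      then have "ennreal (w powr r) \<le> ennreal c * level_integral (\<lambda>t. \<phi> t powr r) (\<lambda>s. mean n (\<lambda>k. distr_fun r (x k) s))"
        using w0 r lev by (intro main[rule_format] n conjI level_function_distr_fun) auto
      then have "ennreal (inverse c) * ennreal (w powr r)
          \<le> ennreal (inverse c) * (ennreal c * level_integral (\<lambda>t. \<phi> t powr r) (\<lambda>s. mean n (\<lambda>k. distr_fun r (x k) s)))"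
        by (rule mult_left_mono) simp
      also have "\<dots> = level_integral (\<lambda>t. \<phi> t powr r) (\<lambda>s. mean n (\<lambda>k. distr_fun r (x k) s))"
        using c by (simp add: mult.assoc[symmetric] ennreal_mult[symmetric])
      finally have "ennreal (inverse c * w powr r) \<le> level_integral (\<lambda>t. \<phi> t powr r) (\<lambda>s. mean n (\<lambda>k. distr_fun r (x k) s))"
        using c by (simp add: ennreal_mult)
      moreover have "(inverse (c powr (1 / r)) * w) powr r = inverse c * w powr r"
        using c w r by (simp add: powr_mult powr_powr inverse_powr[symmetric])
      ultimately have "ennreal (inverse (c powr (1 / r)) * w) \<le> Lorentz_norm \<phi> r (concat_functions n x)"
        unfolding N
        using c w r by (subst ennreal_le_powr_iff) auto
      then show ?thesis unfolding I_def[symmetric] using w c by (simp add: ennreal_mult)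
    qed
  qed
qed

theorem theorem28:
  fixes \<phi> :: "real \<Rightarrow> real" and r :: real
  assumes "increasing_bijection {0..1} \<phi>"
    and "1 \<le> r"
    and "equivalent_to_norm (Lorentz_space \<phi> r) (Lorentz_norm \<phi> r)"
  shows "(D_convex (Lorentz_space \<phi> r) (Lorentz_norm \<phi> r) \<longleftrightarrow>
            almost_convex (\<lambda>t. phi_tilde \<phi> t powr r)) \<and>
         (D_star_convex (Lorentz_space \<phi> r) (Lorentz_norm \<phi> r) \<longleftrightarrow>
            almost_convex (\<lambda>t. inv_into {1..} (phi_tilde \<phi>) (t powr (1 / r))))"
proof -
  have \<phi>: "unit_bijection \<phi>" using assms(1) by (rule unit_bijection.intro)
  obtain D where D: "D \<ge> 1" "\<forall>t\<in>{0..1}. \<phi> t powr r \<le> D * \<phi> (t / 2) powr r"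
    by (rule equivalent_to_norm_imp_doubling[OF \<phi> assms(2,3)]) (rule that; assumption)
  show ?thesis
    using D_convex_iff[OF \<phi> assms(2) D] D_star_convex_iff[OF \<phi> assms(2)]
      almost_convex_phi_tilde_iff[OF \<phi> assms(2)] almost_convex_phi_tilde_inverse_iff[OF \<phi> assms(2)]
    by blast
qed

end
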